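(* Let $M(x)=\sum_{k\ge 1}\mu(k)x^k$ for $|x|<1$, where $\mu$ is the number-theoretic M\"obius function. Let $\tau$ be the zero of $M'$ of smallest absolute value in $(-1,1)$, so that $M'(\tau)=0$. Let \[ c=\sqrt{-\frac{M(\tau)}{2\pi M''(\tau)}},\qquad \gamma = M(\tau)^{-1}. \] Let $a_k$ be the coefficient of $x^k$ in the reversion (compositional inverse) of the power series $M(x)$, which is also equal to the number of natural exact covering systems (NECS) with $k$ congruences. Then, as $k\to\infty$, \[ a_k\sim c\,\gamma^k\,k^{-3/2}. \]
   Context: For integers $n\ge 1$ and $0\le a<n$, let $\langle a,n\rangle=\{x\in\mathbb Z: x\equiv a \pmod n\}$. An exact covering system (ECS) is a finite set $C=\{\langle a_i,n_i\rangle : i=1,\dots,k\}$ of $k\ge1$ pairwise disjoint residue classes whose union is $\mathbb Z$; its size (number of congruences) is $|C|=k$. For an ECS $C$, a class $\langle a,n\rangle\in C$ and an integer $r\ge 2$, an $r$-split of $C$ is the ECS obtained by removing $\langle a,n\rangle$ from $C$ and replacing it by the $r$ classes $\langle a+jn, rn\rangle$, $j=0,1,\dots,r-1$. A natural exact covering system (NECS) is an ECS that can be obtained from $\{\langle 0,1\rangle\}=\{\mathbb Z\}$ by a finite (possibly empty) sequence of splits, where the value of $r\ge 2$ may vary from split to split. NECS are counted as sets of residue classes. The notation $u_k\sim v_k$ means $u_k/v_k\to 1$ as $k\to\infty$. *)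

theory Defs
  imports "HOL-Analysis.Analysis" "HOL-Computational_Algebra.Computational_Algebra"
    "HOL-Number_Theory.Cong"
begin

text \<open>Since 0 is not squarefree, \<open>moebius_mu 0 = 0\<close>. The series below therefore
  range effectively over \<open>k \<ge> 1\<close>.\<close>

definition moebius_mu :: "nat \<Rightarrow> int" where
  "moebius_mu k = (if squarefree k then (-1) ^ card (prime_factors k) else 0)"

definition moebius_fps :: "real fps" where
  "moebius_fps = Abs_fps (\<lambda>k. of_int (moebius_mu k))"

text \<open>Meaningful only for \<open>\<bar>x\<bar> < 1\<close>.\<close>

definition moebius_M :: "real \<Rightarrow> real" where
  "moebius_M x = (\<Sum>k. of_int (moebius_mu k) * x ^ k)"

definition smallest_zero_deriv_M :: "real \<Rightarrow> bool" where
  "smallest_zero_deriv_M t \<longleftrightarrow>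
     t \<in> {-1<..<1} \<and> deriv moebius_M t = 0 \<and>
     (\<forall>x\<in>{-1<..<1}. deriv moebius_M x = 0 \<longrightarrow> \<bar>t\<bar> \<le> \<bar>x\<bar>)"

definition res_class :: "int \<Rightarrow> int \<Rightarrow> int set" where
  "res_class a n = {x. [x = a] (mod n)}"

text \<open>A congruence is represented by the set of its solutions. For \<open>n \<ge> 1\<close> and
  \<open>0 \<le> a < n\<close> the set \<open>res_class a n\<close> determines both \<open>a\<close> and \<open>n\<close>, so the number of
  congruences of a system is its cardinality.\<close>

definition exact_covering_system :: "int set set \<Rightarrow> bool" where
  "exact_covering_system C \<longleftrightarrow>
     finite C \<and> C \<noteq> {} \<and>
     (\<forall>A\<in>C. \<exists>a n. 1 \<le> n \<and> 0 \<le> a \<and> a < n \<and> A = res_class a n) \<and>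
     pairwise disjnt C \<and> \<Union>C = UNIV"

definition is_split :: "int \<Rightarrow> int set set \<Rightarrow> int set set \<Rightarrow> bool" where
  "is_split r C D \<longleftrightarrow>
     exact_covering_system C \<and> 2 \<le> r \<and>
     (\<exists>a n. 1 \<le> n \<and> 0 \<le> a \<and> a < n \<and> res_class a n \<in> C \<and>
        D = (C - {res_class a n}) \<union> {res_class (a + j * n) (r * n) | j. 0 \<le> j \<and> j < r})"

definition natural_exact_covering_system :: "int set set \<Rightarrow> bool" where
  "natural_exact_covering_system C \<longleftrightarrow>
     exact_covering_system C \<and> (\<lambda>D E. \<exists>r. is_split r D E)\<^sup>*\<^sup>* {res_class 0 1} C"

end

theory Submission
  imports Defs "HOL-Complex_Analysis.Complex_Analysis" "HOL-Probability.Distributions"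
begin

text \<open>
  Counting. A NECS other than \<open>{\<int>}\<close> starts with a \<open>q\<close>-split, after which the \<open>q\<close> classes are refined
  independently by NECS. More is true: whenever \<open>r\<close> divides all moduli of a NECS, the parts of the
  system inside the \<open>r\<close> residue classes modulo \<open>r\<close> are, after rescaling, arbitrary NECS. Hence the NECS whose
  moduli are all divisible by \<open>r\<close> have generating function \<open>A\<^sup>r\<close>, where \<open>A\<close> counts all NECS. Since only \<open>{\<int>}\<close>
  has moduli of greatest common divisor 1, summing over \<open>r\<close> with weight \<open>\<mu>(r)\<close> gives \<open>M(A(x)) = x\<close>.

  Asymptotics. By Lagrange inversion and Cauchy's formula, \<open>k a\<^sub>k\<close> is the mean over \<open>\<bar>t\<bar> \<le> \<pi>\<close> of
  \<open>z M(z)\<^sup>-\<^sup>k\<close> with \<open>z = \<tau> e\<^sup>i\<^sup>t\<close>. The circle passes through the critical point \<open>\<tau>\<close> of \<open>M\<close>, and on it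
  \<open>\<bar>M(z)\<bar> \<ge> M(\<tau>) + \<tau>\<^sup>2 (1 - cos t) / 4\<close>, because \<open>\<tau> < 1/3\<close> makes the term \<open>- z\<^sup>2\<close> of \<open>M\<close> dominate all
  terms from \<open>z\<^sup>6\<close> on, and \<open>- z\<^sup>3\<close> and \<open>- z\<^sup>5\<close> have the right sign. Substituting \<open>t = s / \<surd>k\<close>, dominated convergence turns the
  integral into a Gaussian one.
\<close>

unbundle no vec_syntax

section \<open>Grafting and pulling back systems of residue classes\<close>

definition aff :: "nat \<Rightarrow> nat \<Rightarrow> int set \<Rightarrow> int set" where
  "aff i r A = (\<lambda>x. int i + int r * x) ` A"

definition graft :: "nat \<Rightarrow> (nat \<Rightarrow> int set set) \<Rightarrow> int set set" where
  "graft r F = (\<Union>i<r. aff i r ` F i)"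

definition pull :: "nat \<Rightarrow> nat \<Rightarrow> int set set \<Rightarrow> int set set" where
  "pull r i C = {A. aff i r A \<in> C}"

text \<open>The differences of two elements of a class modulo \<open>n\<close> are exactly the
  multiples of \<open>n\<close>, so this says that \<open>r\<close> divides every modulus without
  having to name the moduli.\<close>

definition moduli_dvd :: "nat \<Rightarrow> int set set \<Rightarrow> bool" where
  "moduli_dvd r C \<longleftrightarrow> (\<forall>A\<in>C. \<forall>x\<in>A. \<forall>y\<in>A. int r dvd x - y)"

text \<open>This is \<^const>\<open>natural_exact_covering_system\<close> seen from the first split instead of the last one.\<close>

inductive nsys :: "int set set \<Rightarrow> bool" where
  nsys_UNIV: "nsys {UNIV}"
| nsys_graft: "2 \<le> q \<Longrightarrow> (\<And>i. i < q \<Longrightarrow> nsys (F i)) \<Longrightarrow> nsys (graft q F)"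

lemma mem_graft: "B \<in> graft q F \<longleftrightarrow> (\<exists>i<q. \<exists>A\<in>F i. B = aff i q A)"
  by (auto simp: graft_def)

lemma mem_aff: "x \<in> aff i r A \<longleftrightarrow> (\<exists>y\<in>A. x = int i + int r * y)"
  by (auto simp: aff_def)

lemma aff_empty_iff [simp]: "aff i r A = {} \<longleftrightarrow> A = {}"
  by (simp add: aff_def)

lemma inj_aff: "r \<ge> 1 \<Longrightarrow> inj (aff i r)"
  unfolding aff_def by (intro injI) (simp add: inj_image_eq_iff inj_def)

lemma aff_eq_iff: "r \<ge> 1 \<Longrightarrow> aff i r A = aff i r B \<longleftrightarrow> A = B"
  using inj_aff[of r i] by (auto dest: injD)

lemma aff_meet_imp_eq:
  assumes "i < r" "j < r" "x \<in> aff i r A" "x \<in> aff j r B"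
  shows "i = j"
proof -
  have "x mod int r = int i" using assms(1,3) by (auto simp: mem_aff)
  moreover have "x mod int r = int j" using assms(2,4) by (auto simp: mem_aff)
  ultimately have "int i = int j" by simp
  then show ?thesis by simp
qed

text \<open>The empty set has the same image for every index, so some nonempty member is required;
  hence the side conditions \<open>{} \<notin> F i\<close> further on.\<close>

lemma aff_eq_imp_index_eq:
  "i < r \<Longrightarrow> j < r \<Longrightarrow> A \<noteq> {} \<Longrightarrow> aff i r A = aff j r B \<Longrightarrow> i = j"
  using aff_meet_imp_eq[of i r j _ A B] by (metis aff_empty_iff all_not_in_conv)

lemma aff_aff: "aff t r (aff s q A) = aff (t + r * s) (r * q) A"
  by (auto simp: aff_def image_image algebra_simps)

lemma pull_pull: "pull q s (pull r t C) = pull (r * q) (t + r * s) C"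
  by (simp add: pull_def aff_aff)

lemma graft_cong: "(\<And>i. i < q \<Longrightarrow> F i = G i) \<Longrightarrow> graft q F = graft q G"
  by (auto simp: graft_def)

lemma graft_1 [simp]: "graft (Suc 0) F = F 0"
  by (auto simp: graft_def aff_def)

lemma pull_graft:
  assumes "i < q" "\<And>i. i < q \<Longrightarrow> {} \<notin> F i"
  shows "pull q i (graft q F) = F i"
proof -
  have "A \<in> F i" if "aff i q A = aff j q B" "j < q" "B \<in> F j" for A B j
  proof -
    have "B \<noteq> {}" using assms(2)[OF that(2)] that(3) by auto
    then have "j = i" using aff_eq_imp_index_eq[of j q i B A] that assms by auto
    then show ?thesis using that aff_eq_iff[of q i A B] by auto
  qed
  then show ?thesis using assms(1) by (auto simp: pull_def mem_graft)
qed

text \<open>The divisibility confines each member to one residue class modulo \<open>q\<close>,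
  which any of its elements determines.\<close>

lemma graft_pull:
  assumes "q \<ge> 1" "moduli_dvd q C" "{} \<notin> C"
  shows "graft q (\<lambda>i. pull q i C) = C"
proof (intro equalityI subsetI)
  fix B assume "B \<in> graft q (\<lambda>i. pull q i C)"
  then show "B \<in> C" by (auto simp: mem_graft pull_def)
next
  fix B assume B: "B \<in> C"
  then obtain x where x: "x \<in> B" using assms by fastforce
  define i where "i = nat (x mod int q)"
  have i: "i < q" "int i = x mod int q" using assms by (auto simp: i_def nat_less_iff)
  have "y \<in> aff i q {z. int i + int q * z \<in> B}" if y: "y \<in> B" for y
  proof -
    have "int q dvd y - x" using assms B x y by (auto simp: moduli_dvd_def)
    then have "y mod int q = int i" using i by (simp add: mod_eq_dvd_iff)
    then have "y = int i + int q * (y div int q)" by (metis mod_mult_div_eq)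
    then show ?thesis using y unfolding mem_aff by (intro bexI[of _ "y div int q"]) auto
  qed
  then have "B = aff i q {z. int i + int q * z \<in> B}" by (auto simp: mem_aff)
  then show "B \<in> graft q (\<lambda>i. pull q i C)"
    using i B unfolding mem_graft pull_def by fastforce
qed

lemma nsys_basic: "nsys C \<Longrightarrow> finite C \<and> C \<noteq> {} \<and> {} \<notin> C"
proof (induction rule: nsys.induct)
  case (nsys_graft q F)
  have "finite (graft q F)" using nsys_graft by (auto simp: graft_def)
  moreover have "graft q F \<noteq> {}"
    using nsys_graft(1) nsys_graft(3)[of 0] by (fastforce simp: graft_def)
  moreover have "{} \<notin> graft q F"
    using nsys_graft(3) by (auto simp: mem_graft aff_def)
  ultimately show ?case by blast
qed auto

text \<open>Grafting with \<open>q = 1\<close> changes nothing. This case occurs in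
  \<open>nsys_pull\<close> when the modulus of the first split divides \<open>r\<close>.\<close>

lemma nsys_graft': "1 \<le> q \<Longrightarrow> (\<And>i. i < q \<Longrightarrow> nsys (F i)) \<Longrightarrow> nsys (graft q F)"
  using nsys_graft[of q F] by (cases "q = 1") auto

lemma moduli_dvd_graft: "moduli_dvd q (graft q F)"
  by (auto simp: moduli_dvd_def graft_def aff_def simp flip: right_diff_distrib)

text \<open>Suppose the first split is a \<open>q\<close>-split, and put \<open>g = gcd q r\<close>. The systems grafted there have moduli divisible by
  \<open>r div g\<close>, so by induction they decompose, and the original system decomposes modulo
  \<open>lcm q r = r * (q div g)\<close>. Regrouping the classes modulo \<open>lcm q r\<close> into classes modulo \<open>r\<close> gives the claim.\<close>

lemma nsys_pull:
  assumes "nsys C" "r \<ge> 1" "moduli_dvd r C" "t < r"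
  shows "nsys (pull r t C)"
  using assms
proof (induction arbitrary: r t rule: nsys.induct)
  case nsys_UNIV
  \<comment> \<open>The elements 1 and 0 of \<open>UNIV\<close> leave only
    \<open>r = 1\<close>.\<close>
  have "int r dvd 1 - 0" using nsys_UNIV unfolding moduli_dvd_def by blast
  then have "r = 1" by simp
  moreover have "pull 1 0 {UNIV} = {UNIV}" by (auto simp: pull_def aff_def)
  ultimately show ?case using nsys_UNIV nsys.nsys_UNIV by simp
next
  case (nsys_graft q F)
  define g where "g = gcd q r"
  define q' r' where "q' = q div g" and "r' = r div g"
  have g: "g > 0" "q = g * q'" "r = g * r'" "coprime q' r'"
    using nsys_graft(1) unfolding g_def q'_def r'_def by (auto intro: div_gcd_coprime)
  have pos: "q' \<ge> 1" "r' \<ge> 1" using nsys_graft(1,4) g by (auto simp: Suc_le_eq intro!: Nat.gr0I)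
  have ne: "{} \<notin> F i" if "i < q" for i using nsys_basic[OF nsys_graft(2)[OF that]] by simp
  let ?C = "graft q F"
  \<comment> \<open>Differences inside a grafted class are multiplied by \<open>q\<close>;
    cancelling \<open>g\<close> and then the coprime factor \<open>q'\<close> leaves divisibility by
    \<open>r'\<close>.\<close>
  have ref: "moduli_dvd r' (F i)" if i: "i < q" for i
  proof -
    have "int r' dvd x - y" if "A \<in> F i" "x \<in> A" "y \<in> A" for A x y
    proof -
      have "aff i q A \<in> ?C" using i that by (auto simp: mem_graft)
      then have "int r dvd (int i + int q * x) - (int i + int q * y)"
        using nsys_graft(5) that unfolding moduli_dvd_def by (auto simp: aff_def)
      then have "int r dvd int q * (x - y)" by (simp add: right_diff_distrib)
      then have "int g * int r' dvd int g * (int q' * (x - y))" using g by (simp add: mult.assoc)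
      then have "int r' dvd int q' * (x - y)" using g(1) by simp
      moreover have "coprime (int r') (int q')" using g(4) by (simp add: coprime_commute)
      ultimately show ?thesis by (simp add: coprime_dvd_mult_right_iff)
    qed
    then show ?thesis by (auto simp: moduli_dvd_def)
  qed
  \<comment> \<open>A class modulo the least common multiple is reached through a class modulo
    \<open>q\<close> followed by one modulo \<open>r'\<close>, where the induction hypothesis
    applies.\<close>
  have sub: "nsys (pull (r * q') u ?C)" if u: "u < r * q'" for u
  proof -
    have eq: "r * q' = q * r'" using g by simp
    have iq: "u mod q < q" using nsys_graft(1) by simp
    have jr: "u div q < r'" using u eq by (metis less_mult_imp_div_less mult.commute)
    have "pull (q * r') (u mod q + q * (u div q)) ?C = pull r' (u div q) (pull q (u mod q) ?C)"
      by (simp only: pull_pull)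
    also have "pull q (u mod q) ?C = F (u mod q)" using pull_graft[OF iq] ne by simp
    finally have "pull (r * q') u ?C = pull r' (u div q) (F (u mod q))" by (simp add: eq)
    then show ?thesis using nsys_graft(3)[OF iq pos(2) ref[OF iq] jr] by simp
  qed
  have "{} \<notin> ?C" using nsys_basic[OF nsys.nsys_graft[OF nsys_graft(1,2)]] by simp
  then have ne': "{} \<notin> pull r t ?C" by (simp add: pull_def aff_def)
  \<comment> \<open>The same cancellation with the roles of \<open>q\<close> and \<open>r\<close>
    exchanged.\<close>
  have "moduli_dvd q' (pull r t ?C)"
  proof -
    have "int q' dvd x - y" if "aff t r A \<in> ?C" "x \<in> A" "y \<in> A" for A x y
    proof -
      have "int q dvd (int t + int r * x) - (int t + int r * y)"
        using moduli_dvd_graft[of q F] that unfolding moduli_dvd_def by (auto simp: aff_def)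
      then have "int q dvd int r * (x - y)" by (simp add: right_diff_distrib)
      then have "int g * int q' dvd int g * (int r' * (x - y))" using g by (simp add: mult.assoc)
      then have "int q' dvd int r' * (x - y)" using g(1) by simp
      moreover have "coprime (int q') (int r')" using g(4) by simp
      ultimately show ?thesis by (simp add: coprime_dvd_mult_right_iff)
    qed
    then show ?thesis by (auto simp: moduli_dvd_def pull_def)
  qed
  then have "pull r t ?C = graft q' (\<lambda>s. pull q' s (pull r t ?C))"
    using graft_pull pos ne' by simp
  also have "nsys \<dots>"
  proof (rule nsys_graft'[OF pos(1)])
    fix s assume s: "s < q'"
    have "t + r * s < r * Suc s" using nsys_graft.prems(3) by simp
    also have "\<dots> \<le> r * q'" using s by (intro mult_left_mono) auto
    finally show "nsys (pull q' s (pull r t ?C))" unfolding pull_pull by (rule sub)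
  qed
  finally show ?case .
qed

section \<open>Counting natural systems\<close>

lemma card_graft:
  assumes "q \<ge> 1" "\<And>i. i < q \<Longrightarrow> finite (F i) \<and> {} \<notin> F i"
  shows "card (graft q F) = (\<Sum>i<q. card (F i))"
proof -
  have "card (graft q F) = (\<Sum>i<q. card (aff i q ` F i))"
    unfolding graft_def
  proof (rule card_UN_disjoint)
    show "\<forall>i\<in>{..<q}. \<forall>j\<in>{..<q}. i \<noteq> j \<longrightarrow> aff i q ` F i \<inter> aff j q ` F j = {}"
    proof (intro ballI impI equals0I)
      fix i j B assume *: "i \<in> {..<q}" "j \<in> {..<q}" "i \<noteq> j" "B \<in> aff i q ` F i \<inter> aff j q ` F j"
      then obtain A A' where "A \<in> F i" "A' \<in> F j" "aff i q A = aff j q A'" by auto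
      moreover have "A \<noteq> {}" using assms(2)[of i] * \<open>A \<in> F i\<close> by auto
      ultimately show False using aff_eq_imp_index_eq[of i q j A A'] * by auto
    qed
  qed (use assms in auto)
  also have "\<dots> = (\<Sum>i<q. card (F i))"
    using inj_aff[OF assms(1)] by (intro sum.cong refl card_image) (auto intro: inj_on_subset)
  finally show ?thesis by simp
qed

definition systems_of_card :: "nat \<Rightarrow> int set set set" where
  "systems_of_card k = {C. nsys C \<and> card C = k}"

text \<open>Lists record the grafted systems at the indices below \<open>r\<close> only; functions
  differing elsewhere would give the same graft.\<close>

definition system_lists :: "nat \<Rightarrow> nat \<Rightarrow> int set set list set" where
  "system_lists r k = {Cs. length Cs = r \<and> (\<forall>C\<in>set Cs. nsys C) \<and> sum_list (map card Cs) = k}"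

lemma nsys_card_ge_1: "nsys C \<Longrightarrow> card C \<ge> 1"
  using nsys_basic[of C] by (simp add: Suc_le_eq card_gt_0_iff)

text \<open>The inverse pulls back along all \<open>r\<close> classes. Surjectivity rests on
  \<open>nsys_pull\<close>: the pulled back parts are again natural.\<close>

lemma bij_betw_graft_lists:
  assumes "r \<ge> 1"
  shows "bij_betw (\<lambda>Cs. graft r ((!) Cs)) (system_lists r k)
           {C. nsys C \<and> moduli_dvd r C \<and> card C = k}"
proof -
  have inv: "map (\<lambda>i. pull r i (graft r ((!) Cs))) [0..<r] = Cs" if "Cs \<in> system_lists r k" for Cs
  proof -
    have "pull r i (graft r ((!) Cs)) = Cs ! i" if "i < r" for i
      using that \<open>Cs \<in> _\<close> by (intro pull_graft) (auto simp: system_lists_def nsys_basic)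
    then show ?thesis using that by (intro nth_equalityI) (auto simp: system_lists_def)
  qed
  have "graft r ((!) Cs) \<in> {C. nsys C \<and> moduli_dvd r C \<and> card C = k}"
    if Cs: "Cs \<in> system_lists r k" for Cs
  proof -
    have *: "nsys (Cs ! i)" if "i < r" for i using Cs that by (auto simp: system_lists_def)
    have "card (graft r ((!) Cs)) = (\<Sum>i<r. card (Cs ! i))"
      using * nsys_basic by (intro card_graft[OF assms]) auto
    also have "\<dots> = k" using Cs
      by (auto simp: system_lists_def sum_list_sum_nth atLeast0LessThan intro!: sum.cong)
    finally show ?thesis using * nsys_graft'[OF assms] moduli_dvd_graft by auto
  qed
  moreover have "C \<in> (\<lambda>Cs. graft r ((!) Cs)) ` system_lists r k"
    if C: "nsys C" "moduli_dvd r C" "card C = k" for C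
  proof -
    let ?Cs = "map (\<lambda>i. pull r i C) [0..<r]"
    have *: "nsys (pull r i C)" if "i < r" for i using nsys_pull C assms that by auto
    have eq: "graft r ((!) ?Cs) = C"
    proof -
      have "graft r ((!) ?Cs) = graft r (\<lambda>i. pull r i C)" by (rule graft_cong) simp
      also have "\<dots> = C" using graft_pull assms C nsys_basic by blast
      finally show ?thesis .
    qed
    have "k = card (graft r ((!) ?Cs))" using C eq by simp
    also have "\<dots> = (\<Sum>i<r. card (?Cs ! i))"
      using * nsys_basic by (intro card_graft[OF assms]) auto
    finally have "?Cs \<in> system_lists r k"
      using * by (auto simp: system_lists_def sum_list_sum_nth atLeast0LessThan intro!: sum.cong)
    then show ?thesis using eq by (intro image_eqI[of _ _ ?Cs]) auto
  qed
  moreover have "inj_on (\<lambda>Cs. graft r ((!) Cs)) (system_lists r k)"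
    by (rule inj_on_inverseI[of _ "\<lambda>C. map (\<lambda>i. pull r i C) [0..<r]"]) (rule inv)
  ultimately show ?thesis unfolding bij_betw_def by blast
qed

text \<open>The system consists of \<open>r\<close> grafted parts, each with at least one
  class.\<close>

lemma moduli_dvd_imp_le_card:
  assumes "nsys C" "moduli_dvd r C" "r \<ge> 1"
  shows "r \<le> card C"
proof -
  obtain Cs where Cs: "Cs \<in> system_lists r (card C)"
    using bij_betw_imp_surj_on[OF bij_betw_graft_lists[OF assms(3), of "card C"]] assms by blast
  then have "length Cs \<le> sum_list (map card Cs)"
  proof -
    have "\<forall>C\<in>set Cs. 1 \<le> card C" using Cs nsys_card_ge_1 by (auto simp: system_lists_def)
    then show ?thesis by (induction Cs) auto
  qed
  then show ?thesis using Cs by (simp add: system_lists_def)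
qed

lemma nsys_cases:
  assumes "nsys C" "C \<noteq> {UNIV}"
  obtains q F where "q \<ge> 2" "\<And>i. i < q \<Longrightarrow> nsys (F i)" "C = graft q F"
  using assms by (cases rule: nsys.cases) auto

text \<open>By its first split, a nontrivial system is grafted from at most \<open>k\<close> parts,
  and each part is smaller than the whole because there is another nonempty one.\<close>

lemma finite_systems_of_card: "finite (systems_of_card k)"
proof (induction k rule: less_induct)
  case (less k)
  let ?S = "\<Union>j<k. systems_of_card j"
  have "systems_of_card k \<subseteq>
    insert {UNIV} (\<Union>q\<le>k. (\<lambda>Cs. graft q ((!) Cs)) ` {Cs. set Cs \<subseteq> ?S \<and> length Cs = q})"
  proof
    fix C assume "C \<in> systems_of_card k"
    then have C: "nsys C" "card C = k" by (auto simp: systems_of_card_def)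
    show "C \<in> insert {UNIV} (\<Union>q\<le>k. (\<lambda>Cs. graft q ((!) Cs)) ` {Cs. set Cs \<subseteq> ?S \<and> length Cs = q})"
    proof (cases "C = {UNIV}")
      case False
      then obtain q F where q: "q \<ge> 2" "\<And>i. i < q \<Longrightarrow> nsys (F i)" "C = graft q F"
        using nsys_cases[OF C(1) False] by blast
      have qk: "q \<le> k" using moduli_dvd_imp_le_card[of C q] moduli_dvd_graft[of q F] C q by simp
      have k: "k = (\<Sum>i<q. card (F i))" using card_graft[of q F] q nsys_basic[OF q(2)] C by simp
      have "card (F i) < k" if i: "i < q" for i
      proof -
        \<comment> \<open>Any index other than \<open>i\<close>; it exists because
          \<open>q \<ge> 2\<close>.\<close>
        define j where "j = (if i = 0 then 1 else 0 :: nat)"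
        have j: "j < q" "j \<noteq> i" using q(1) by (auto simp: j_def)
        have "card (F i) < card (F i) + card (F j)" using nsys_card_ge_1[OF q(2)[OF j(1)]] by simp
        also have "\<dots> = (\<Sum>i\<in>{i,j}. card (F i))" using j by simp
        also have "\<dots> \<le> (\<Sum>i<q. card (F i))" using i j by (intro sum_mono2) auto
        finally show ?thesis using k by simp
      qed
      then have "set (map F [0..<q]) \<subseteq> ?S" using q by (auto simp: systems_of_card_def)
      moreover have "C = graft q ((!) (map F [0..<q]))" unfolding q(3) by (rule graft_cong) simp
      ultimately have "C \<in> (\<lambda>Cs. graft q ((!) Cs)) ` {Cs. set Cs \<subseteq> ?S \<and> length Cs = q}"
        by (intro image_eqI[of _ _ "map F [0..<q]"]) simp_all
      then show ?thesis using qk by (intro insertI2 UN_I[of q]) simp_all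
    qed simp
  qed
  moreover have "finite ?S" using less by auto
  then have "finite (\<Union>q\<le>k. (\<lambda>Cs. graft q ((!) Cs)) ` {Cs. set Cs \<subseteq> ?S \<and> length Cs = q})"
    by (intro finite_UN_I finite_imageI finite_lists_length_eq) simp_all
  ultimately show ?case by (meson finite_insert finite_subset)
qed

text \<open>Polymorphic because the real coefficients are to be estimated while Cauchy's formula
  speaks of complex ones.\<close>

definition system_fps :: "'a :: comm_semiring_1 fps" where
  "system_fps = Abs_fps (\<lambda>k. of_nat (card (systems_of_card k)))"

lemma system_lists_Suc:
  "system_lists (Suc r) k =
     (\<Union>i\<in>{0..k}. (\<lambda>(C, Cs). C # Cs) ` (systems_of_card i \<times> system_lists r (k - i)))"
proof (intro equalityI subsetI)
  fix Ds assume "Ds \<in> system_lists (Suc r) k"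
  then obtain C Cs where "Ds = C # Cs" "nsys C" "card C \<le> k" "Cs \<in> system_lists r (k - card C)"
    by (cases Ds) (auto simp: system_lists_def)
  then show "Ds \<in> (\<Union>i\<in>{0..k}. (\<lambda>(C, Cs). C # Cs) ` (systems_of_card i \<times> system_lists r (k - i)))"
    by (intro UN_I[of "card C"] image_eqI[of _ _ "(C, Cs)"]) (auto simp: systems_of_card_def)
qed (auto simp: system_lists_def systems_of_card_def)

lemma finite_system_lists: "finite (system_lists r k)"
proof (induction r arbitrary: k)
  case 0
  have "system_lists 0 k \<subseteq> {[]}" by (auto simp: system_lists_def)
  then show ?case by (rule finite_subset) simp
next
  case (Suc r)
  then show ?case by (auto simp: system_lists_Suc finite_systems_of_card)
qed

text \<open>Splitting off the head of a list corresponds to the Cauchy product with one more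
  factor.\<close>

lemma system_fps_power_nth: "(system_fps ^ r) $ k = of_nat (card (system_lists r k))"
proof (induction r arbitrary: k)
  case 0
  have "system_lists 0 k = (if k = 0 then {[]} else {})" by (auto simp: system_lists_def)
  then show ?case by simp
next
  case (Suc r)
  have "card (system_lists (Suc r) k) =
      (\<Sum>i=0..k. card ((\<lambda>(C, Cs). C # Cs) ` (systems_of_card i \<times> system_lists r (k - i))))"
    unfolding system_lists_Suc
    by (rule card_UN_disjoint)
       (auto simp: finite_systems_of_card finite_system_lists, auto simp: systems_of_card_def)
  also have "\<dots> = (\<Sum>i=0..k. card (systems_of_card i) * card (system_lists r (k - i)))"
    by (intro sum.cong refl) (subst card_image; auto simp: inj_on_def card_cartesian_product)
  moreover have "(system_fps :: 'a fps) $ i = of_nat (card (systems_of_card i))" for i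
    by (simp add: system_fps_def)
  ultimately show ?case by (simp add: fps_mult_nth Suc)
qed

section \<open>Moebius inversion\<close>

lemma moebius_mu_prime_mult:
  assumes "prime p" "squarefree d" "\<not> p dvd d"
  shows "moebius_mu (p * d) = - moebius_mu d"
proof -
  have d0: "d \<noteq> 0" "p \<noteq> 0" using assms by (auto intro: Nat.gr0I)
  have "coprime p d" using assms by (simp add: prime_imp_coprime)
  then have "squarefree (p * d)"
    using assms by (intro squarefree_mult_coprime) (auto simp: squarefree_prime)
  moreover have "prime_factors (p * d) = insert p (prime_factors d)"
    using d0 assms by (simp add: prime_factors_product prime_prime_factors)
  moreover have "p \<notin> prime_factors d" using assms by auto
  ultimately show ?thesis using assms by (simp add: moebius_mu_def)
qed

lemma sum_moebius_mu_dvd: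
  assumes "n \<ge> 1"
  shows "(\<Sum>d | d dvd n. moebius_mu d) = (if n = 1 then 1 else 0)"
proof (cases "n = 1")
  case True
  then show ?thesis by (simp add: moebius_mu_def)
next
  case False
  then obtain p where p: "prime p" "p dvd n" using prime_factor_nat by blast
  \<comment> \<open>The squarefree divisors pair off as \<open>d\<close>, \<open>p * d\<close> with opposite values.\<close>
  define D where "D = {d. d dvd n \<and> squarefree d \<and> \<not> p dvd d}"
  have fin: "finite {d. d dvd n}" using assms by simp
  have "(\<Sum>d | d dvd n. moebius_mu d) = (\<Sum>d\<in>D \<union> (*) p ` D. moebius_mu d)"
  proof (rule sum.mono_neutral_right[OF fin])
    show "D \<union> (*) p ` D \<subseteq> {d. d dvd n}"
    proof -
      have "p * d dvd n" if "d \<in> D" for d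
        using that p by (intro divides_mult) (auto simp: D_def prime_imp_coprime)
      then show ?thesis by (auto simp: D_def)
    qed
    show "\<forall>d\<in>{d. d dvd n} - (D \<union> (*) p ` D). moebius_mu d = 0"
    proof
      fix d assume d: "d \<in> {d. d dvd n} - (D \<union> (*) p ` D)"
      show "moebius_mu d = 0"
      proof (rule ccontr)
        assume "moebius_mu d \<noteq> 0"
        then have sq: "squarefree d" by (auto simp: moebius_mu_def split: if_splits)
        then have "p dvd d" using d by (auto simp: D_def)
        then obtain e where e: "d = p * e" by auto
        have "\<not> p dvd e"
        proof
          assume "p dvd e"
          then have "p ^ 2 dvd d" by (simp add: e power2_eq_square)
          then show False using sq p by (auto simp: squarefree_def)
        qed
        moreover have "squarefree e" using sq e squarefree_multD by blast
        moreover have "e dvd n" using d e by (auto dest: dvd_mult_right)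
        ultimately show False using d e by (auto simp: D_def)
      qed
    qed
  qed
  also have "\<dots> = (\<Sum>d\<in>D. moebius_mu d) + (\<Sum>d\<in>(*) p ` D. moebius_mu d)"
    using fin by (intro sum.union_disjoint) (auto simp: D_def)
  also have "(\<Sum>d\<in>(*) p ` D. moebius_mu d) = (\<Sum>d\<in>D. moebius_mu (p * d))"
    using p by (subst sum.reindex) (auto simp: inj_on_def)
  also have "\<dots> = (\<Sum>d\<in>D. - moebius_mu d)"
    using p by (intro sum.cong) (auto simp: D_def moebius_mu_prime_mult)
  finally show ?thesis using False by (simp add: sum_negf)
qed

text \<open>The greatest common divisor of the moduli, as the differences within a class modulo
  \<open>n\<close> are the multiples of \<open>n\<close>. \<open>Gcd\<close> is nonnegative, so
  \<open>nat\<close> loses nothing.\<close>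

definition moduli_gcd :: "int set set \<Rightarrow> nat" where
  "moduli_gcd C = nat (Gcd {x - y | x y A. A \<in> C \<and> x \<in> A \<and> y \<in> A})"

lemma moduli_dvd_iff_dvd_gcd: "moduli_dvd r C \<longleftrightarrow> r dvd moduli_gcd C"
proof -
  let ?S = "{x - y | x y A. A \<in> C \<and> x \<in> A \<and> y \<in> A}"
  have "moduli_dvd r C \<longleftrightarrow> (\<forall>d\<in>?S. int r dvd d)" unfolding moduli_dvd_def by blast
  also have "\<dots> \<longleftrightarrow> int r dvd Gcd ?S" by (simp add: dvd_Gcd_iff)
  also have "\<dots> \<longleftrightarrow> int r dvd int (moduli_gcd C)" by (simp add: moduli_gcd_def)
  finally show ?thesis by simp
qed

text \<open>If it were 0, every \<open>r\<close> would divide all moduli, against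
  \<open>r \<le> card C\<close> for \<open>r = Suc (card C)\<close>.\<close>

lemma moduli_gcd_pos: "nsys C \<Longrightarrow> moduli_gcd C > 0"
  using moduli_dvd_imp_le_card[of C "Suc (card C)"] by (auto simp: moduli_dvd_iff_dvd_gcd intro!: Nat.gr0I)

text \<open>A system other than \<open>{UNIV}\<close> starts with a \<open>q\<close>-split, and then
  \<open>q \<ge> 2\<close> divides all moduli.\<close>

lemma moduli_gcd_eq_1_iff:
  assumes "nsys C"
  shows "moduli_gcd C = 1 \<longleftrightarrow> C = {UNIV}"
proof
  assume 1: "moduli_gcd C = 1"
  show "C = {UNIV}"
  proof (rule ccontr)
    assume "C \<noteq> {UNIV}"
    then obtain q F where q: "q \<ge> 2" "C = graft q F" using nsys_cases[OF assms] by blast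
    then have "q dvd moduli_gcd C" using moduli_dvd_graft by (simp flip: moduli_dvd_iff_dvd_gcd)
    then show False using 1 q by simp
  qed
next
  assume "C = {UNIV}"
  then have "moduli_dvd (moduli_gcd C) {UNIV}" by (simp add: moduli_dvd_iff_dvd_gcd)
  then have "int (moduli_gcd C) dvd 1 - 0" unfolding moduli_dvd_def by blast
  then show "moduli_gcd C = 1" by simp
qed

text \<open>Coefficient \<open>n\<close> is the sum of \<open>moebius_mu i\<close> over the pairs of
  a system of size \<open>n\<close> and a common divisor \<open>i\<close> of its moduli. Summing
  over \<open>i\<close> first leaves only the systems whose moduli have greatest common divisor
  1.\<close>

lemma moebius_compose_system_fps:
  "Abs_fps (\<lambda>k. of_int (moebius_mu k)) oo system_fps = (fps_X :: 'a :: comm_ring_1 fps)"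
proof (rule fps_ext)
  fix n
  let ?S = "systems_of_card n"
  \<comment> \<open>The index 0 is split off because the counting bijection requires
    \<open>i \<ge> 1\<close>; its weight is 0.\<close>
  have "(\<Sum>i=0..n. moebius_mu i * int (card (system_lists i n)))
      = (\<Sum>i=1..n. moebius_mu i * int (card (system_lists i n)))"
  proof (rule sum.mono_neutral_right)
    show "\<forall>i\<in>{0..n} - {1..n}. moebius_mu i * int (card (system_lists i n)) = 0"
    proof
      fix i assume "i \<in> {0..n} - {1..n}"
      then have "i = 0" by auto
      then show "moebius_mu i * int (card (system_lists i n)) = 0" by (simp add: moebius_mu_def)
    qed
  qed auto
  also have "\<dots> = (\<Sum>i=1..n. moebius_mu i * int (card {C\<in>?S. moduli_dvd i C}))"
  proof (intro sum.cong refl)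
    fix i assume "i \<in> {1..n}"
    then have "card (system_lists i n) = card {C. nsys C \<and> moduli_dvd i C \<and> card C = n}"
      using bij_betw_graft_lists[of i n] by (auto intro: bij_betw_same_card)
    also have "{C. nsys C \<and> moduli_dvd i C \<and> card C = n} = {C\<in>?S. moduli_dvd i C}"
      by (auto simp: systems_of_card_def)
    finally show "moebius_mu i * int (card (system_lists i n)) =
        moebius_mu i * int (card {C\<in>?S. moduli_dvd i C})" by simp
  qed
  also have "\<dots> = (\<Sum>i=1..n. \<Sum>C\<in>?S. if moduli_dvd i C then moebius_mu i else 0)"
    by (simp add: finite_systems_of_card mult.commute flip: sum.inter_filter)
  also have "\<dots> = (\<Sum>C\<in>?S. \<Sum>i=1..n. if moduli_dvd i C then moebius_mu i else 0)"
    by (rule sum.swap)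
  also have "\<dots> = (\<Sum>C\<in>?S. if C = {UNIV} then 1 else 0)"
  proof (intro sum.cong refl)
    fix C assume "C \<in> ?S"
    then have C: "nsys C" "card C = n" by (auto simp: systems_of_card_def)
    have pos: "moduli_gcd C \<ge> 1" using moduli_gcd_pos[OF C(1)] by simp
    \<comment> \<open>Ensures that the range \<open>{1..n}\<close> contains every divisor of the
      greatest common divisor.\<close>
    have le: "moduli_gcd C \<le> n"
      using moduli_dvd_imp_le_card[OF C(1) _ pos] C by (simp add: moduli_dvd_iff_dvd_gcd)
    have "i \<in> {1..n} \<and> moduli_dvd i C \<longleftrightarrow> i dvd moduli_gcd C" for i
      using pos le dvd_imp_le[of i "moduli_gcd C"]
      by (auto simp: moduli_dvd_iff_dvd_gcd Suc_le_eq intro!: Nat.gr0I)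
    then have "{i\<in>{1..n}. moduli_dvd i C} = {i. i dvd moduli_gcd C}" by blast
    then have "(\<Sum>i=1..n. if moduli_dvd i C then moebius_mu i else 0)
        = (\<Sum>i | i dvd moduli_gcd C. moebius_mu i)"
      by (simp flip: sum.inter_filter)
    then show "(\<Sum>i=1..n. if moduli_dvd i C then moebius_mu i else 0) = (if C = {UNIV} then 1 else 0)"
      using sum_moebius_mu_dvd[OF pos] moduli_gcd_eq_1_iff[OF C(1)] by simp
  qed
  also have "\<dots> = int (card (?S \<inter> {{UNIV}}))"
    by (simp add: finite_systems_of_card sum.If_cases)
  also have "?S \<inter> {{UNIV}} = (if n = 1 then {{UNIV}} else {})"
    by (auto simp: systems_of_card_def nsys_UNIV)
  finally have *: "(\<Sum>i=0..n. moebius_mu i * int (card (system_lists i n))) = (if n = 1 then 1 else 0)"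
    by (simp split: if_splits)
  have "(Abs_fps (\<lambda>k. of_int (moebius_mu k)) oo (system_fps :: 'a fps)) $ n
      = of_int (\<Sum>i=0..n. moebius_mu i * int (card (system_lists i n)))"
    by (simp add: fps_compose_nth system_fps_power_nth)
  also have "\<dots> = (fps_X :: 'a fps) $ n" unfolding * by simp
  finally show "(Abs_fps (\<lambda>k. of_int (moebius_mu k)) oo system_fps) $ n = (fps_X :: 'a fps) $ n" .
qed

section \<open>Natural systems and splits\<close>

lemma mem_res_class: "x \<in> res_class a n \<longleftrightarrow> n dvd x - a"
  by (simp add: res_class_def cong_iff_dvd_diff)

lemma res_class_eqI: "n dvd x - a \<Longrightarrow> res_class x n = res_class a n"
proof -
  assume "n dvd x - a"
  then have "x mod n = a mod n" by (simp add: mod_eq_dvd_iff)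
  then show ?thesis by (simp add: res_class_def cong_def)
qed

lemma res_class_modulus_dvd: "res_class a n = res_class b m \<Longrightarrow> m dvd n"
proof -
  assume *: "res_class a n = res_class b m"
  have "a \<in> res_class a n" "a + n \<in> res_class a n" by (auto simp: mem_res_class)
  then have "m dvd a - b" "m dvd (a + n) - b" by (auto simp: * mem_res_class)
  then have "m dvd ((a + n) - b) - (a - b)" by (rule dvd_diff[rotated])
  then show ?thesis by simp
qed

lemma res_class_modulus_eq:
  "res_class a n = res_class b m \<Longrightarrow> 0 \<le> n \<Longrightarrow> 0 \<le> m \<Longrightarrow> n = m"
  using res_class_modulus_dvd[of a n b m] res_class_modulus_dvd[of b m a n]
  by (simp add: zdvd_antisym_nonneg)

lemma res_class_1: "res_class 0 1 = UNIV"
  by (auto simp: mem_res_class)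

lemma aff_res_class:
  "q \<ge> 1 \<Longrightarrow> aff i q (res_class a n) = res_class (int i + int q * a) (int q * n)"
proof (intro equalityI subsetI)
  fix x assume q: "q \<ge> 1" and x: "x \<in> res_class (int i + int q * a) (int q * n)"
  then obtain k where "x - (int i + int q * a) = int q * n * k" by (auto simp: mem_res_class)
  then have "x = int i + int q * (a + n * k)" by (simp add: algebra_simps)
  then show "x \<in> aff i q (res_class a n)" by (auto simp: mem_aff mem_res_class)
qed (auto simp: mem_aff mem_res_class simp flip: right_diff_distrib)

text \<open>A form of splitting suited to induction: the pieces are indexed by all points of the
  class, so no representative has to be reduced and affine images need no reindexing.\<close>

definition split_class :: "int \<Rightarrow> int set set \<Rightarrow> int set set \<Rightarrow> bool" where
  "split_class r C D \<longleftrightarrow> (\<exists>a n. 1 \<le> n \<and> res_class a n \<in> C \<and>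
     D = C - {res_class a n} \<union> (\<lambda>x. res_class x (r * n)) ` res_class a n)"

text \<open>Affine images commute with splitting, and the image of \<open>A\<close> occurs in the
  graft only once, at index \<open>i\<close>.\<close>

lemma graft_split:
  assumes "i < q" "A \<in> F i" "A \<noteq> {}"
  shows "graft q (F(i := F i - {A} \<union> (\<lambda>x. res_class x m) ` A)) =
         graft q F - {aff i q A} \<union> (\<lambda>x. res_class x (int q * m)) ` aff i q A" (is "?L = ?R")
proof -
  let ?G = "F(i := F i - {A} \<union> (\<lambda>x. res_class x m) ` A)"
  have q: "q \<ge> 1" using assms(1) by simp
  have ne: "aff j q B \<noteq> aff i q A" if "j < q" "j \<noteq> i \<or> B \<noteq> A" for j B
    using aff_eq_imp_index_eq[of i q j A B] aff_eq_iff[OF q, of i A B] that assms by metis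
  have pieces: "aff i q ` (\<lambda>x. res_class x m) ` A = (\<lambda>x. res_class x (int q * m)) ` aff i q A"
    by (simp add: aff_def[of i q A] image_image aff_res_class[OF q])
  have L: "?L = (\<Union>j\<in>{..<q} - {i}. aff j q ` F j) \<union> aff i q ` (F i - {A})
      \<union> aff i q ` (\<lambda>x. res_class x m) ` A"
  proof -
    have "{..<q} = insert i ({..<q} - {i})" using assms(1) by auto
    then have "?L = (\<Union>j\<in>insert i ({..<q} - {i}). aff j q ` ?G j)" unfolding graft_def by argo
    also have "\<dots> = aff i q ` ?G i \<union> (\<Union>j\<in>{..<q} - {i}. aff j q ` ?G j)"
      by (rule UN_insert)
    also have "(\<Union>j\<in>{..<q} - {i}. aff j q ` ?G j) = (\<Union>j\<in>{..<q} - {i}. aff j q ` F j)"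
      by (intro SUP_cong) auto
    finally show ?thesis by (simp only: fun_upd_same image_Un Un_ac)
  qed
  have "(\<Union>j\<in>{..<q} - {i}. aff j q ` F j) \<union> aff i q ` (F i - {A}) = graft q F - {aff i q A}"
    (is "?X = ?Y")
  proof (intro equalityI subsetI)
    fix B assume "B \<in> ?X"
    then obtain j B' where "j < q" "B' \<in> F j" "B = aff j q B'" "j \<noteq> i \<or> B' \<noteq> A"
      using assms(1) by auto
    then show "B \<in> ?Y" using ne[of j B'] by (auto simp: mem_graft)
  next
    fix B assume "B \<in> ?Y"
    then obtain j B' where "j < q" "B' \<in> F j" "B = aff j q B'" "B \<noteq> aff i q A"
      by (auto simp: mem_graft)
    then show "B \<in> ?X" by (cases "j = i") auto
  qed
  then show ?thesis using L pieces by simp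
qed

lemma split_class_graft:
  assumes "i < q" "split_class r (F i) D"
  shows "split_class r (graft q F) (graft q (F(i := D)))"
proof -
  obtain a n where an: "1 \<le> n" "res_class a n \<in> F i"
      "D = F i - {res_class a n} \<union> (\<lambda>x. res_class x (r * n)) ` res_class a n"
    using assms(2) by (auto simp: split_class_def)
  have "a \<in> res_class a n" by (simp add: mem_res_class)
  then have "graft q (F(i := D)) = graft q F - {aff i q (res_class a n)} \<union>
      (\<lambda>x. res_class x (int q * (r * n))) ` aff i q (res_class a n)"
    unfolding an(3) using an assms by (intro graft_split) auto
  moreover have "aff i q (res_class a n) = res_class (int i + int q * a) (int q * n)"
    using assms by (intro aff_res_class) auto
  moreover have "aff i q (res_class a n) \<in> graft q F" using assms an by (auto simp: mem_graft)
  moreover have "1 \<le> int q * n" using assms an by (simp add: int_one_le_iff_zero_less)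
  ultimately show ?thesis
    unfolding split_class_def
    by (intro exI[of _ "int i + int q * a"] exI[of _ "int q * n"]) (simp add: mult.left_commute)
qed

lemma nsys_res_class: "nsys C \<Longrightarrow> A \<in> C \<Longrightarrow> \<exists>a n. 1 \<le> n \<and> A = res_class a n"
proof (induction arbitrary: A rule: nsys.induct)
  case nsys_UNIV
  then show ?case using res_class_1 by (intro exI[of _ 0] exI[of _ 1]) auto
next
  case (nsys_graft q F)
  then obtain i B where i: "i < q" "B \<in> F i" "A = aff i q B" by (auto simp: mem_graft)
  then obtain a n where "1 \<le> n" "B = res_class a n" using nsys_graft by blast
  then have "A = res_class (int i + int q * a) (int q * n)" "1 \<le> int q * n"
    using i by (simp_all add: aff_res_class int_one_le_iff_zero_less)
  then show ?case by blast
qed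

lemma graft_singletons: "q \<ge> 1 \<Longrightarrow> graft q (\<lambda>_. {UNIV}) = range (\<lambda>x. res_class x (int q))"
proof -
  assume q: "q \<ge> 1"
  have aff: "aff i q UNIV = res_class (int i) (int q)" for i
    using aff_res_class[OF q, of i 0 1] by (simp add: res_class_1)
  have "res_class x (int q) \<in> (\<lambda>i. res_class (int i) (int q)) ` {..<q}" for x
  proof -
    have "res_class x (int q) = res_class (int (nat (x mod int q))) (int q)"
      using q by (intro res_class_eqI) (simp add: minus_mod_eq_mult_div)
    moreover have "nat (x mod int q) < q" using q by (simp add: nat_less_iff)
    ultimately show ?thesis by blast
  qed
  then show ?thesis by (auto simp: graft_def aff)
qed

text \<open>A split takes place inside one of the systems grafted at the first split, so it can be
  pushed down until it meets \<open>{UNIV}\<close>, where it is a first split itself.\<close>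

lemma nsys_split_class:
  assumes "nsys C" "split_class r C D" "2 \<le> r"
  shows "nsys D"
  using assms
proof (induction arbitrary: D rule: nsys.induct)
  case nsys_UNIV
  then obtain a n where an: "1 \<le> n" "res_class a n = UNIV"
      "D = (\<lambda>x. res_class x (r * n)) ` UNIV" by (auto simp: split_class_def)
  have "n = 1" using res_class_modulus_eq[of a n 0 1] an by (simp add: res_class_1)
  then have "D = graft (nat r) (\<lambda>_. {UNIV})" using graft_singletons[of "nat r"] an nsys_UNIV by simp
  then show ?case using nsys_UNIV nsys_graft[of "nat r"] nsys.nsys_UNIV by simp
next
  case (nsys_graft q F)
  obtain a n where an: "1 \<le> n" "res_class a n \<in> graft q F"
      "D = graft q F - {res_class a n} \<union> (\<lambda>x. res_class x (r * n)) ` res_class a n"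
    using nsys_graft.prems by (auto simp: split_class_def)
  then obtain i A where i: "i < q" "A \<in> F i" "res_class a n = aff i q A" by (auto simp: mem_graft)
  then obtain b m where b: "1 \<le> m" "A = res_class b m" using nsys_res_class nsys_graft.hyps by blast
  have "res_class a n = res_class (int i + int q * b) (int q * m)"
    using i b by (simp add: aff_res_class)
  \<comment> \<open>A nonnegative modulus is determined by the set. Hence the pieces have modulus
    \<open>int q * (r * m)\<close> and are the images of pieces of \<open>A\<close>.\<close>
  then have n: "n = int q * m" using res_class_modulus_eq an b by simp
  define E where "E = F i - {A} \<union> (\<lambda>x. res_class x (r * m)) ` A"
  have "b \<in> A" using b by (simp add: mem_res_class)
  then have "D = graft q (F(i := E))"
    using graft_split[of i q A F "r * m"] i an(3) by (auto simp: E_def n mult.left_commute)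
  moreover have "nsys E"
    using nsys_graft.IH[OF i(1), of E] nsys_graft.prems i b unfolding split_class_def E_def by blast
  ultimately show ?case using nsys_graft.hyps nsys.nsys_graft[of q "F(i := E)"] by simp
qed

text \<open>Undoing the last split, by descending to a grafted system that can still be coarsened.\<close>

lemma nsys_unsplit:
  assumes "nsys C" "C \<noteq> {UNIV}"
  shows "\<exists>r D. 2 \<le> r \<and> nsys D \<and> card D < card C \<and> split_class r D C"
  using assms
proof (induction rule: nsys.induct)
  case (nsys_graft q F)
  have cardC: "card (graft q F) = (\<Sum>i<q. card (F i))" if "\<And>i. i < q \<Longrightarrow> nsys (F i)" for F
    using nsys_graft.hyps that nsys_basic by (intro card_graft) auto
  show ?case
  proof (cases "\<forall>i<q. F i = {UNIV}")
    case True
    \<comment> \<open>All grafted parts are trivial, so the first split is also the last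
      one.\<close>
    then have C: "graft q F = graft q (\<lambda>_. {UNIV})" by (intro graft_cong) auto
    have "split_class (int q) {UNIV} (graft q F)"
      unfolding C split_class_def using graft_singletons[of q] nsys_graft.hyps res_class_1
      by (intro exI[of _ 0] exI[of _ 1]) auto
    moreover have "card {UNIV :: int set} < card (graft q F)"
      using moduli_dvd_imp_le_card[OF nsys.nsys_graft[of q F] moduli_dvd_graft] nsys_graft.hyps by simp
    ultimately show ?thesis using nsys.nsys_UNIV nsys_graft.hyps by (intro exI[of _ "int q"]) auto
  next
    case False
    then obtain i where i: "i < q" "F i \<noteq> {UNIV}" by blast
    then obtain r D where D: "2 \<le> r" "nsys D" "card D < card (F i)" "split_class r D (F i)"
      using nsys_graft.IH by blast
    let ?G = "F(i := D)"
    have G: "nsys (?G j)" if "j < q" for j using that nsys_graft.hyps D by simp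
    \<comment> \<open>\<open>F\<close> arises from \<open>?G\<close> by putting \<open>F i\<close>
      back, so the last split of \<open>F i\<close> is a last split of the whole system.\<close>
    have "split_class r (graft q ?G) (graft q (?G(i := F i)))"
      using i D by (intro split_class_graft) auto
    moreover have "?G(i := F i) = F" by auto
    moreover have "card (graft q ?G) < card (graft q F)"
    proof -
      have "(\<Sum>j<q. card (?G j)) < (\<Sum>j<q. card (F j))"
        using i D by (intro sum_strict_mono_ex1) (auto intro!: bexI[of _ i])
      then show ?thesis using cardC G nsys_graft.hyps by simp
    qed
    moreover have "nsys (graft q ?G)" using G nsys_graft.hyps nsys.nsys_graft by blast
    ultimately show ?thesis using D(1) by (intro exI[of _ r] exI[of _ "graft q ?G"]) simp
  qed
qed auto

section \<open>Equivalence with sequences of splits\<close>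

lemma nsys_exact_covering_system:
  assumes "nsys C"
  shows "exact_covering_system C"
proof -
  have "pairwise disjnt C \<and> \<Union>C = UNIV"
    using assms
  proof (induction rule: nsys.induct)
    case (nsys_graft q F)
    have "disjnt (aff i q A) (aff j q B)"
      if *: "i < q" "j < q" "A \<in> F i" "B \<in> F j" "aff i q A \<noteq> aff j q B" for i j A B
      unfolding disjnt_iff
    proof (intro notI allI, elim conjE)
      fix x assume x: "x \<in> aff i q A" "x \<in> aff j q B"
      then have "i = j" using aff_meet_imp_eq * by blast
      moreover from this have "disjnt A B"
        using * nsys_graft.IH[of i] by (auto simp: pairwise_def)
      ultimately show False using x * by (auto simp: mem_aff disjnt_iff)
    qed
    note disj = this
    have "pairwise disjnt (graft q F)"
    proof (rule pairwiseI)
      fix B B' assume *: "B \<in> graft q F" "B' \<in> graft q F" "B \<noteq> B'"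
      then obtain i j A A' where "i < q" "j < q" "A \<in> F i" "A' \<in> F j"
          "B = aff i q A" "B' = aff j q A'" unfolding mem_graft by blast
      with *(3) show "disjnt B B'" using disj[of i j A A'] by blast
    qed
    moreover have "x \<in> \<Union>(graft q F)" for x
    proof -
      define i where "i = nat (x mod int q)"
      have i: "i < q" "int i = x mod int q" using nsys_graft.hyps by (auto simp: i_def nat_less_iff)
      have "x div int q \<in> \<Union>(F i)" using nsys_graft.IH[OF i(1)] by simp
      then obtain A where A: "A \<in> F i" "x div int q \<in> A" by (rule UnionE)
      have "x = int i + int q * (x div int q)" unfolding i(2) by simp
      then have "x \<in> aff i q A" unfolding mem_aff using A(2) by (rule bexI)
      moreover have "aff i q A \<in> graft q F" using i(1) A(1) by (auto simp: mem_graft)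
      ultimately show ?thesis by (rule UnionI[rotated])
    qed
    ultimately show ?case by (simp add: set_eq_iff)
  qed simp
  moreover have "\<exists>a n. 1 \<le> n \<and> 0 \<le> a \<and> a < n \<and> A = res_class a n" if "A \<in> C" for A
  proof -
    obtain a n where "1 \<le> n" "A = res_class a n" using nsys_res_class[OF assms \<open>A \<in> C\<close>] by blast
    moreover have "res_class a n = res_class (a mod n) n"
      by (rule res_class_eqI) (simp add: minus_mod_eq_mult_div)
    ultimately show ?thesis by (intro exI[of _ "a mod n"] exI[of _ n]) simp
  qed
  ultimately show ?thesis using nsys_basic[OF assms] by (auto simp: exact_covering_system_def)
qed

lemma res_class_pieces:
  assumes "1 \<le> n" "1 \<le> r"
  shows "{res_class (a + j * n) (r * n) | j. 0 \<le> j \<and> j < r} = (\<lambda>x. res_class x (r * n)) ` res_class a n"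
proof (intro equalityI subsetI)
  fix B assume "B \<in> (\<lambda>x. res_class x (r * n)) ` res_class a n"
  then obtain x where x: "n dvd x - a" "B = res_class x (r * n)" by (auto simp: mem_res_class)
  then obtain k where k: "x - a = n * k" by auto
  \<comment> \<open>The point \<open>a + n * k\<close> lies in the piece with index
    \<open>k mod r\<close>.\<close>
  have "x - (a + (k mod r) * n) = r * n * (k div r)"
  proof -
    have "x - (a + (k mod r) * n) = n * (k - k mod r)" using k by (simp add: algebra_simps)
    then show ?thesis by (simp add: minus_mod_eq_mult_div mult.left_commute)
  qed
  then have "B = res_class (a + (k mod r) * n) (r * n)" unfolding x(2) by (intro res_class_eqI) simp
  then show "B \<in> {res_class (a + j * n) (r * n) | j. 0 \<le> j \<and> j < r}"
    using assms by (intro CollectI exI[of _ "k mod r"]) simp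
qed (auto simp: mem_res_class)

lemma is_split_iff:
  "is_split r C D \<longleftrightarrow> exact_covering_system C \<and> 2 \<le> r \<and> split_class r C D"
proof -
  have *: "res_class a n = res_class (a mod n) n" for a n
    by (rule res_class_eqI) (simp add: minus_mod_eq_mult_div)
  have "split_class r C D \<longleftrightarrow> (\<exists>a n. 1 \<le> n \<and> 0 \<le> a \<and> a < n \<and> res_class a n \<in> C \<and>
     D = C - {res_class a n} \<union> (\<lambda>x. res_class x (r * n)) ` res_class a n)" (is "_ \<longleftrightarrow> ?split")
    unfolding split_class_def
  proof (intro iffI; elim exE)
    fix a n assume "1 \<le> n \<and> res_class a n \<in> C \<and>
      D = C - {res_class a n} \<union> (\<lambda>x. res_class x (r * n)) ` res_class a n"
    then show ?split using *[of a n] by (intro exI[of _ "a mod n"] exI[of _ n]) simp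
  qed blast
  moreover have "is_split r C D \<longleftrightarrow> exact_covering_system C \<and> 2 \<le> r \<and> ?split"
    unfolding is_split_def using res_class_pieces[of _ r]
    by (intro conj_cong refl ex_cong1) simp
  ultimately show ?thesis by blast
qed

text \<open>Splits preserve \<open>nsys\<close>. Conversely, a member of \<open>nsys\<close> is
  traced back to \<open>{UNIV}\<close> by undoing splits, which lowers the cardinality each
  time.\<close>

lemma natural_exact_covering_system_iff_nsys: "natural_exact_covering_system C \<longleftrightarrow> nsys C"
proof
  assume "natural_exact_covering_system C"
  then have "(\<lambda>D E. \<exists>r. is_split r D E)\<^sup>*\<^sup>* {res_class 0 1} C"
    by (simp add: natural_exact_covering_system_def)
  then show "nsys C"
  proof (induction rule: rtranclp_induct)
    case base
    show ?case by (simp add: res_class_1 nsys_UNIV)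
  next
    case (step D E)
    then show ?case using nsys_split_class by (auto simp: is_split_iff)
  qed
next
  assume "nsys C"
  then have "(\<lambda>D E. \<exists>r. is_split r D E)\<^sup>*\<^sup>* {res_class 0 1} C"
  proof (induction "card C" arbitrary: C rule: less_induct)
    case less
    show ?case
    proof (cases "C = {UNIV}")
      case False
      then obtain r D where D: "2 \<le> r" "nsys D" "card D < card C" "split_class r D C"
        using nsys_unsplit less.prems by blast
      then have "\<exists>r. is_split r D C" using nsys_exact_covering_system by (auto simp: is_split_iff)
      then show ?thesis using less.hyps[OF D(3,2)] by (rule rtranclp.rtrancl_into_rtrancl[rotated])
    qed (simp add: res_class_1)
  qed
  then show "natural_exact_covering_system C"
    using \<open>nsys C\<close> nsys_exact_covering_system by (simp add: natural_exact_covering_system_def)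
qed

section \<open>The generating function as a reversion\<close>

text \<open>\<open>fps_inv M\<close> is a left inverse, \<open>A\<close> a right inverse, and
  composition is associative.\<close>

lemma fps_inv_unique:
  fixes M A :: "'a :: field fps"
  assumes "M $ 0 = 0" "M $ 1 \<noteq> 0" "A $ 0 = 0" "M oo A = fps_X"
  shows "A = fps_inv M"
proof -
  have "A = (fps_inv M oo M) oo A" using fps_inv[OF assms(1,2)] assms(3) by simp
  also have "\<dots> = fps_inv M oo (M oo A)" using assms by (intro fps_compose_assoc[symmetric])
  finally show ?thesis using assms by simp
qed

lemma system_fps_nth_0: "(system_fps :: 'a :: comm_semiring_1 fps) $ 0 = 0"
proof -
  have "systems_of_card 0 = {}" using nsys_card_ge_1 by (fastforce simp: systems_of_card_def)
  then show ?thesis by (simp add: system_fps_def)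
qed

lemma system_fps_eq_fps_inv:
  "system_fps = fps_inv (Abs_fps (\<lambda>k. of_int (moebius_mu k)) :: 'a :: field fps)"
  by (intro fps_inv_unique moebius_compose_system_fps system_fps_nth_0) (simp_all add: moebius_mu_def)

lemma fps_inv_moebius_nth:
  "finite {C. natural_exact_covering_system C \<and> card C = k}"
  "fps_inv moebius_fps $ k = real (card {C. natural_exact_covering_system C \<and> card C = k})"
proof -
  have eq: "{C. natural_exact_covering_system C \<and> card C = k} = systems_of_card k"
    by (simp add: systems_of_card_def natural_exact_covering_system_iff_nsys)
  show "fps_inv moebius_fps $ k = real (card {C. natural_exact_covering_system C \<and> card C = k})"
    unfolding eq moebius_fps_def system_fps_eq_fps_inv[symmetric] by (simp add: system_fps_def)
  show "finite {C. natural_exact_covering_system C \<and> card C = k}"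
    by (simp add: eq finite_systems_of_card)
qed

section \<open>Lagrange inversion\<close>

text \<open>With \<open>M = X g\<close> this says that \<open>M' / M\<^sup>n\<^sup>+\<^sup>1\<close> has residue 0 for \<open>n > 0\<close> and 1 for \<open>n = 0\<close>.\<close>

lemma fps_nth_inverse_power_residue:
  fixes g :: "'a :: field_char_0 fps"
  assumes "g $ 0 \<noteq> 0"
  shows "(inverse g ^ Suc n * (g + fps_X * fps_deriv g)) $ n = (if n = 0 then 1 else 0)"
proof -
  let ?h = "inverse g"
  have hg: "?h * g = 1" by (rule inverse_mult_eq_1[OF assms])
  show ?thesis
  proof (cases "n = 0")
    case True
    then show ?thesis using assms by simp
  next
    case False
    define E where "E = ?h ^ Suc n * fps_deriv g"
    have "fps_deriv (?h ^ n) = fps_const (- of_nat n) * E"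
    proof -
      obtain m where n: "n = Suc m" using False not0_implies_Suc by blast
      have "fps_deriv (?h ^ Suc m) = fps_const (of_nat (Suc m)) * (- fps_deriv g * ?h ^ 2) * ?h ^ m"
        by (simp only: fps_deriv_power fps_inverse_deriv[OF assms] diff_Suc_1)
      also have "\<dots> = - fps_const (of_nat (Suc m)) * (?h ^ Suc (Suc m) * fps_deriv g)"
        by (simp only: power_Suc power2_eq_square mult_minus_left mult_minus_right mult_ac)
      finally show ?thesis unfolding n E_def by (simp only: fps_const_neg)
    qed
    then have "fps_X * fps_deriv (?h ^ n) = fps_const (- of_nat n) * (fps_X * E)"
      by (simp only: mult.left_commute)
    then have "(fps_X * fps_deriv (?h ^ n)) $ n = - of_nat n * (fps_X * E) $ n"
      by (simp only: fps_mult_left_const_nth)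
    \<comment> \<open>With \<open>f = ?h ^ n\<close> this computes the same coefficient a second
      time.\<close>
    moreover have "(fps_X * fps_deriv f) $ n = of_nat n * f $ n" for f :: "'a fps"
      by (cases n) simp_all
    ultimately have "of_nat n * ((fps_X * E) $ n + (?h ^ n) $ n) = 0"
      by (simp only: distrib_left mult_minus_left) simp
    then have "(fps_X * E) $ n + (?h ^ n) $ n = 0" using False by simp
    moreover have "?h ^ Suc n * (g + fps_X * fps_deriv g) = ?h ^ n * (?h * g) + fps_X * E"
      by (simp only: E_def power_Suc distrib_left mult_ac)
    ultimately show ?thesis using False hg by (simp add: add.commute)
  qed
qed

text \<open>The chain rule gives A'(M) M' = 1. Multiplying by the \<open>k\<close>-th power of
  \<open>inverse g\<close> and taking coefficient \<open>k - 1\<close> turns the powers of M into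
  residues, which vanish except for one coefficient of A'.\<close>

lemma fps_lagrange_inversion:
  fixes A g :: "'a :: field_char_0 fps"
  assumes g0: "g $ 0 \<noteq> 0" and inv: "A oo (fps_X * g) = fps_X" and k: "k \<ge> 1"
  shows "of_nat k * A $ k = (inverse g ^ k) $ (k - 1)"
proof -
  let ?h = "inverse g" and ?M = "fps_X * g"
  have hg: "?h * g = 1" by (rule inverse_mult_eq_1[OF g0])
  have dM: "fps_deriv ?M = g + fps_X * fps_deriv g" by simp
  have M0: "?M $ 0 = 0" by simp
  have "fps_deriv (A oo ?M) = (fps_deriv A oo ?M) * fps_deriv ?M"
    by (rule fps_compose_deriv) simp
  then have one: "(fps_deriv A oo ?M) * fps_deriv ?M = 1" using inv by simp
  \<comment> \<open>The \<open>j\<close> factors \<open>g\<close> of \<open>?M ^ j\<close> cancel;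
    what remains is the residue for \<open>n = k - 1 - j\<close>.\<close>
  have coef: "(?M ^ j * (fps_deriv ?M * ?h ^ k)) $ (k - 1) = (if j = k - 1 then 1 else 0)"
    if j: "j \<le> k - 1" for j
  proof -
    define n where "n = k - 1 - j"
    have kn: "k = j + Suc n" using j k by (simp add: n_def)
    have "g ^ j * ?h ^ j = 1" using hg by (simp add: mult.commute flip: power_mult_distrib)
    moreover have "?M ^ j * (fps_deriv ?M * ?h ^ k)
        = fps_X ^ j * (g ^ j * ?h ^ j) * (?h ^ Suc n * (g + fps_X * fps_deriv g))"
      unfolding dM kn by (simp only: power_mult_distrib power_add mult_ac)
    ultimately have "?M ^ j * (fps_deriv ?M * ?h ^ k)
        = fps_X ^ j * (?h ^ Suc n * (g + fps_X * fps_deriv g))" by (simp only: mult_1_right)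
    then have "(?M ^ j * (fps_deriv ?M * ?h ^ k)) $ (k - 1) = (?h ^ Suc n * (g + fps_X * fps_deriv g)) $ n"
      using kn by (simp only: fps_X_power_mult_nth) simp
    then show ?thesis using fps_nth_inverse_power_residue[OF g0, of n] kn by simp
  qed
  \<comment> \<open>Powers \<open>?M ^ j\<close> with \<open>j > i\<close> do not contribute, so the
    range of \<open>j\<close> can be made independent of \<open>i\<close> and the sums
    exchanged.\<close>
  have trunc: "(fps_deriv A oo ?M) $ i = (\<Sum>j=0..k-1. fps_deriv A $ j * (?M ^ j) $ i)"
    if "i \<le> k - 1" for i
    unfolding fps_compose_nth using that startsby_zero_power_prefix[OF M0]
    by (intro sum.mono_neutral_left) auto
  let ?W = "fps_deriv ?M * ?h ^ k"
  have "(?h ^ k) $ (k - 1) = ((fps_deriv A oo ?M) * ?W) $ (k - 1)"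
    using one by (simp flip: mult.assoc)
  also have "\<dots> = (\<Sum>i=0..k-1. (\<Sum>j=0..k-1. fps_deriv A $ j * (?M ^ j) $ i) * ?W $ (k - 1 - i))"
    unfolding fps_mult_nth[of "fps_deriv A oo ?M"] using trunc by (intro sum.cong) auto
  also have "\<dots> = (\<Sum>j=0..k-1. fps_deriv A $ j * (\<Sum>i=0..k-1. (?M ^ j) $ i * ?W $ (k - 1 - i)))"
    unfolding sum_distrib_right sum_distrib_left by (subst sum.swap) (simp only: mult.assoc)
  also have "\<dots> = (\<Sum>j=0..k-1. fps_deriv A $ j * (if j = k - 1 then 1 else 0))"
  proof (intro sum.cong refl)
    fix j assume "j \<in> {0..k-1}"
    then show "fps_deriv A $ j * (\<Sum>i=0..k-1. (?M ^ j) $ i * ?W $ (k - 1 - i)) =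
        fps_deriv A $ j * (if j = k - 1 then 1 else 0)"
      using coef[of j] unfolding fps_mult_nth[of "?M ^ j"] by simp
  qed
  also have "\<dots> = (\<Sum>j=0..k-1. if j = k - 1 then fps_deriv A $ j else 0)"
    by (intro sum.cong) simp_all
  also have "\<dots> = fps_deriv A $ (k - 1)"
    by (simp only: sum.delta finite_atLeastAtMost) simp
  also have "\<dots> = of_nat k * A $ k" using k by simp
  finally show ?thesis by simp
qed

section \<open>The critical point of the Moebius series\<close>

lemma abs_moebius_mu_le_1: "\<bar>moebius_mu n\<bar> \<le> 1"
  by (simp add: moebius_mu_def power_abs)

lemma moebius_mu_values:
  "moebius_mu 0 = 0" "moebius_mu 1 = 1" "moebius_mu 2 = -1" "moebius_mu 3 = -1"
  "moebius_mu 4 = 0" "moebius_mu 5 = -1"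
proof -
  show 1: "moebius_mu 0 = 0" "moebius_mu 1 = 1" by (simp_all add: moebius_mu_def)
  have prime: "moebius_mu p = -1" if "prime p" for p
    using moebius_mu_prime_mult[of p 1] prime_gt_1_nat[OF that] that 1 by simp
  show "moebius_mu 2 = -1" "moebius_mu 3 = -1" "moebius_mu 5 = -1" by (intro prime; simp)+
  have "\<not> squarefree (4 :: nat)"
  proof
    assume "squarefree (4 :: nat)"
    moreover have "(2 :: nat) ^ 2 dvd 4" by simp
    ultimately have "(2 :: nat) dvd 1" unfolding squarefree_def by blast
    then show False by simp
  qed
  then show "moebius_mu 4 = 0" by (simp add: moebius_mu_def)
qed

text \<open>Covers real and complex scalars together: the critical point is found on the real line,
  the coefficient integrals are complex.\<close>

definition moebius_series :: "'a :: {banach, real_normed_field} fps" where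
  "moebius_series = Abs_fps (\<lambda>k. of_int (moebius_mu k))"

lemma moebius_series_nth [simp]: "fps_nth moebius_series k = of_int (moebius_mu k)"
  by (simp add: moebius_series_def)

lemma norm_of_int_moebius_mu_le_1: "norm (of_int (moebius_mu n) :: 'a :: real_normed_field) \<le> 1"
  using abs_moebius_mu_le_1[of n] by simp

lemma conv_radius_moebius_series:
  "fps_conv_radius (moebius_series :: 'a :: {banach, real_normed_field} fps) \<ge> 1"
  unfolding fps_conv_radius_def
proof (rule conv_radius_geI_ex)
  fix r :: real assume r: "0 < r" "ereal r < 1"
  have "summable (\<lambda>n. fps_nth moebius_series n * (of_real r :: 'a) ^ n)"
  proof (rule summable_comparison_test')
    show "summable (\<lambda>n. r ^ n)" using r by (intro summable_geometric) auto
    show "norm (fps_nth moebius_series n * (of_real r :: 'a) ^ n) \<le> r ^ n" for n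
      using norm_of_int_moebius_mu_le_1[where ?'a = 'a, of n] r
      by (simp add: norm_mult norm_power mult_left_le_one_le del: norm_of_int)
  qed
  then show "\<exists>z. norm z = r \<and> summable (\<lambda>n. fps_nth moebius_series n * (z :: 'a) ^ n)"
    using r by (intro exI[of _ "of_real r"]) simp
qed

section \<open>Derivatives of the series inside the unit disc\<close>

lemma conv_radius_moebius_derivs:
  "fps_conv_radius ((fps_deriv ^^ j) (moebius_series :: 'a :: {banach, real_normed_field} fps)) \<ge> 1"
proof (induction j)
  case (Suc j)
  then show ?case using fps_conv_radius_deriv order_trans by fastforce
qed (simp add: conv_radius_moebius_series)

lemma has_field_derivative_moebius_derivs:
  fixes z :: "'a :: {banach, real_normed_field}"
  assumes "norm z < 1"
  shows "(eval_fps ((fps_deriv ^^ j) moebius_series) has_field_derivative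
    eval_fps ((fps_deriv ^^ Suc j) moebius_series) z) (at z within S)"
proof -
  have "ereal (norm z) < 1" using assms by simp
  also have "1 \<le> fps_conv_radius ((fps_deriv ^^ j) (moebius_series :: 'a fps))"
    by (rule conv_radius_moebius_derivs)
  finally show ?thesis using has_field_derivative_eval_fps by auto
qed

lemma moebius_M_eq: "moebius_M = eval_fps moebius_series"
  by (simp add: fun_eq_iff moebius_M_def eval_fps_def)

lemma deriv_moebius_M:
  assumes "\<bar>x\<bar> < 1"
  shows "deriv moebius_M x = eval_fps (fps_deriv moebius_series) x"
  using has_field_derivative_moebius_derivs[of x 0 UNIV] assms
  by (auto simp: moebius_M_eq intro: DERIV_imp_deriv)

lemma has_derivative_deriv_moebius_M:
  assumes "\<bar>x\<bar> < 1"
  shows "(deriv moebius_M has_field_derivative eval_fps (fps_deriv (fps_deriv moebius_series)) x) (at x)"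
proof -
  have "open {-1<..<1::real}" "x \<in> {-1<..<1}" using assms by auto
  \<comment> \<open>\<open>deriv moebius_M\<close> is identified with a power series only inside the
    unit disc, so its derivative is transferred through a neighbourhood of \<open>x\<close>.\<close>
  then have "eventually (\<lambda>y. y \<in> {-1<..<1}) (nhds x)" by (rule eventually_nhds_in_open)
  then have "eventually (\<lambda>y. deriv moebius_M y = eval_fps (fps_deriv moebius_series) y) (nhds x)"
    by eventually_elim (auto simp: deriv_moebius_M)
  then show ?thesis
    using has_field_derivative_moebius_derivs[of x 1 UNIV] assms by (simp add: DERIV_cong_ev)
qed

lemma deriv_deriv_moebius_M:
  "\<bar>x\<bar> < 1 \<Longrightarrow> deriv (deriv moebius_M) x = eval_fps (fps_deriv (fps_deriv moebius_series)) x"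
  using has_derivative_deriv_moebius_M by (rule DERIV_imp_deriv)

lemma sums_deriv_moebius_M:
  assumes "\<bar>x\<bar> < 1"
  shows "(\<lambda>n. real (n + 1) * of_int (moebius_mu (n + 1)) * x ^ n) sums deriv moebius_M x"
proof -
  have "ereal (norm x) < 1" using assms by simp
  also have "1 \<le> fps_conv_radius ((fps_deriv ^^ 1) (moebius_series :: real fps))"
    by (rule conv_radius_moebius_derivs)
  finally have "(\<lambda>n. fps_nth (fps_deriv moebius_series) n * x ^ n) sums eval_fps (fps_deriv moebius_series) x"
    using sums_eval_fps[of x "fps_deriv moebius_series"] by simp
  then show ?thesis using deriv_moebius_M[OF assms] by (simp add: algebra_simps)
qed

lemma sums_deriv_deriv_moebius_M:
  assumes "\<bar>x\<bar> < 1"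
  shows "(\<lambda>n. real (n + 1) * real (n + 2) * of_int (moebius_mu (n + 2)) * x ^ n) sums deriv (deriv moebius_M) x"
proof -
  have "ereal (norm x) < 1" using assms by simp
  also have "1 \<le> fps_conv_radius ((fps_deriv ^^ 2) (moebius_series :: real fps))"
    by (rule conv_radius_moebius_derivs)
  finally have "(\<lambda>n. fps_nth (fps_deriv (fps_deriv moebius_series)) n * x ^ n) sums
      eval_fps (fps_deriv (fps_deriv moebius_series)) x"
    using sums_eval_fps[of x "fps_deriv (fps_deriv moebius_series)"] by (simp add: numeral_2_eq_2)
  then show ?thesis using deriv_deriv_moebius_M[OF assms] by (simp add: algebra_simps)
qed

text \<open>The value of 1 / (1 - x)^2 at 1/3, a majorant for the derivative series where
  \<open>\<bar>x\<bar> \<le> 1 / 3\<close>. \<open>sums_quadratic_thirds\<close> does the same for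
  the second derivative and for the estimate on circles.\<close>

lemma sums_linear_thirds: "(\<lambda>n. real (n + 1) / 3 ^ n) sums (9 / 4)"
  using geometric_deriv_sums[of "1 / 3 :: real"] by (simp add: power_one_over power2_eq_square divide_simps)

lemma sums_quadratic_thirds: "(\<lambda>n. real (n + 1) * real (n + 2) / 3 ^ n) sums (27 / 4)"
proof -
  \<comment> \<open>Solved from \<open>f n - f (n + 1) = (n + 1) (n + 2) / 3\<^sup>n\<close> with a quadratic numerator.\<close>
  define f where "f n = (3 / 2 * real n ^ 2 + 6 * real n + 27 / 4) / 3 ^ n" for n
  have "f \<longlonglongrightarrow> 0" unfolding f_def by real_asymp
  then have "(\<lambda>n. f n - f (Suc n)) sums (f 0 - 0)" by (rule telescope_sums')
  moreover have "f n - f (Suc n) = real (n + 1) * real (n + 2) / 3 ^ n" for n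
    by (simp add: f_def field_simps power2_eq_square)
  ultimately show ?thesis by (simp add: f_def)
qed

section \<open>Signs of the first two derivatives near 0\<close>

lemma moebius_term_bound:
  fixes x c :: real
  assumes "\<bar>x\<bar> \<le> 1 / 3" "c \<ge> 0"
  shows "\<bar>c * of_int (moebius_mu m) * x ^ n\<bar> \<le> c / 3 ^ n"
proof -
  have "\<bar>x\<bar> ^ n \<le> (1 / 3) ^ n" using assms by (intro power_mono) auto
  moreover have "\<bar>of_int (moebius_mu m) :: real\<bar> \<le> 1" using abs_moebius_mu_le_1[of m] by linarith
  ultimately have "\<bar>of_int (moebius_mu m) :: real\<bar> * \<bar>x\<bar> ^ n \<le> 1 * (1 / 3) ^ n"
    by (intro mult_mono) auto
  then have "c * (\<bar>of_int (moebius_mu m) :: real\<bar> * \<bar>x\<bar> ^ n) \<le> c * (1 * (1 / 3) ^ n)"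
    using assms by (intro mult_left_mono) auto
  then show ?thesis using assms by (simp add: abs_mult power_abs power_one_over mult.assoc)
qed

lemma deriv_moebius_M_pos:
  assumes "- 1 / 3 \<le> x" "x \<le> 0"
  shows "deriv moebius_M x > 0"
proof -
  \<comment> \<open>The first coefficients exactly, the others by absolute value at 1/3; \<open>c\<close> is the correction.\<close>
  define c :: "nat \<Rightarrow> real" where "c n = (if n = 0 then 2 else 2 / 3)" for n
  have "(\<lambda>n. if n \<in> {..<2} then c n else 0) sums (\<Sum>n<2. c n)" by (rule sums_If_finite_set) simp
  then have "(\<lambda>n. (if n \<in> {..<2} then c n else 0) - real (n + 1) / 3 ^ n) sums ((\<Sum>n<2. c n) - 9 / 4)"
    using sums_linear_thirds by (rule sums_diff)
  note bound = this
  \<comment> \<open>The lower bound is 5 / 12. \<open>c 0 = 2\<close> lifts -1 to the exact term 1,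
    and \<open>c 1\<close> lifts -2/3 to 0, which suffices because the term - 2 x is nonnegative for
    \<open>x \<le> 0\<close>.\<close>
  have "(\<Sum>n<2. c n) - 9 / 4 \<le> deriv moebius_M x"
  proof (rule sums_le[OF _ bound sums_deriv_moebius_M])
    fix n :: nat
    have "n = 0 \<or> n = 1 \<or> 2 \<le> n" by auto
    then show "(if n \<in> {..<2} then c n else 0) - real (n + 1) / 3 ^ n \<le>
        real (n + 1) * of_int (moebius_mu (n + 1)) * x ^ n"
      using moebius_term_bound[of x "real (n + 1)" "n + 1" n, THEN abs_le_D2] assms moebius_mu_values
        moebius_mu_values(3,4)[unfolded numeral_2_eq_2 numeral_3_eq_3]
      by (auto simp: c_def)
  qed (use assms in auto)
  then show ?thesis by (simp add: c_def lessThan_nat_numeral)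
qed

lemma deriv_moebius_M_third_neg: "deriv moebius_M (1 / 3) < 0"
proof -
  \<comment> \<open>The exact terms at 1/3 minus their majorants, for five terms. The resulting
    bound is only -7 / 324, and without the fifth term it would be positive.\<close>
  define c :: "nat \<Rightarrow> real" where
    "c n = (if n = 0 then 0 else if n = 1 then - 4 / 3 else if n = 2 then - 2 / 3
       else if n = 3 then - 4 / 27 else - 10 / 81)" for n
  have "(\<lambda>n. if n \<in> {..<5} then c n else 0) sums (\<Sum>n<5. c n)" by (rule sums_If_finite_set) simp
  then have "(\<lambda>n. (if n \<in> {..<5} then c n else 0) + real (n + 1) / 3 ^ n) sums ((\<Sum>n<5. c n) + 9 / 4)"
    using sums_linear_thirds by (rule sums_add)
  note bound = this
  have "deriv moebius_M (1 / 3) \<le> (\<Sum>n<5. c n) + 9 / 4"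
  proof (rule sums_le[OF _ sums_deriv_moebius_M bound])
    fix n :: nat
    have "n = 0 \<or> n = 1 \<or> n = 2 \<or> n = 3 \<or> n = 4 \<or> 5 \<le> n" by auto
    then show "real (n + 1) * of_int (moebius_mu (n + 1)) * (1 / 3) ^ n \<le>
        (if n \<in> {..<5} then c n else 0) + real (n + 1) / 3 ^ n"
      using moebius_term_bound[of "1 / 3" "real (n + 1)" "n + 1" n, THEN abs_le_D1] moebius_mu_values
        moebius_mu_values(3,4)[unfolded numeral_2_eq_2 numeral_3_eq_3]
      by (auto simp: c_def power_one_over)
  qed auto
  then show ?thesis by (simp add: c_def lessThan_nat_numeral)
qed

lemma deriv_deriv_moebius_M_neg:
  assumes "0 \<le> x" "x \<le> 1 / 3"
  shows "deriv (deriv moebius_M) x < 0"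
proof -
  \<comment> \<open>Corrections to the majorants 2, 2 and 4/3: the exact terms are -2, - 6 x and 0,
    of which the second is bounded by 0 because \<open>x \<ge> 0\<close>. The resulting bound is -7
    / 12.\<close>
  define c :: "nat \<Rightarrow> real" where
    "c n = (if n = 0 then - 4 else if n = 1 then - 2 else - 4 / 3)" for n
  have "(\<lambda>n. if n \<in> {..<3} then c n else 0) sums (\<Sum>n<3. c n)" by (rule sums_If_finite_set) simp
  then have "(\<lambda>n. (if n \<in> {..<3} then c n else 0) + real (n + 1) * real (n + 2) / 3 ^ n) sums
      ((\<Sum>n<3. c n) + 27 / 4)"
    using sums_quadratic_thirds by (rule sums_add)
  note bound = this
  have "deriv (deriv moebius_M) x \<le> (\<Sum>n<3. c n) + 27 / 4"
  proof (rule sums_le[OF _ sums_deriv_deriv_moebius_M bound])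
    fix n :: nat
    have "n = 0 \<or> n = 1 \<or> n = 2 \<or> 3 \<le> n" by auto
    then show "real (n + 1) * real (n + 2) * of_int (moebius_mu (n + 2)) * x ^ n \<le>
        (if n \<in> {..<3} then c n else 0) + real (n + 1) * real (n + 2) / 3 ^ n"
      using moebius_term_bound[of x "real (n + 1) * real (n + 2)" "n + 2" n, THEN abs_le_D1] moebius_mu_values assms
        moebius_mu_values(3,4)[unfolded numeral_2_eq_2 numeral_3_eq_3]
      by (auto simp: c_def)
  qed (use assms in auto)
  then show ?thesis by (simp add: c_def lessThan_nat_numeral)
qed

text \<open>The derivative is positive on [-1/3, 0] and strictly decreasing on [0, 1/3].\<close>

lemma deriv_moebius_M_zero_unique:
  assumes "\<bar>x\<bar> \<le> 1 / 3" "\<bar>y\<bar> \<le> 1 / 3" "deriv moebius_M x = 0" "deriv moebius_M y = 0"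
  shows "x = y"
proof -
  have False if "x < y" "\<bar>x\<bar> \<le> 1 / 3" "\<bar>y\<bar> \<le> 1 / 3" "deriv moebius_M x = 0" "deriv moebius_M y = 0" for x y
  proof -
    have "x > 0" using deriv_moebius_M_pos[of x] that by (force simp: abs_le_iff)
    have "deriv moebius_M x > deriv moebius_M y"
    proof (rule DERIV_neg_imp_decreasing[OF \<open>x < y\<close>])
      fix z assume z: "x \<le> z" "z \<le> y"
      show "\<exists>d. (deriv moebius_M has_real_derivative d) (at z) \<and> d < 0"
        using has_derivative_deriv_moebius_M[of z] deriv_deriv_moebius_M[of z]
          deriv_deriv_moebius_M_neg[of z] z that \<open>x > 0\<close> by auto
    qed
    then show False using that by simp
  qed
  from this[of x y] this[of y x] show ?thesis
    using assms by (cases x y rule: linorder_cases) auto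
qed

text \<open>The intermediate value theorem gives a zero between 0 and 1/3. Any other zero in (-1, 1)
  has absolute value above 1/3, so there is no competitor, not even of opposite sign.\<close>

lemma ex1_smallest_zero_deriv_M:
  "\<exists>!t. smallest_zero_deriv_M t"
  "smallest_zero_deriv_M t \<Longrightarrow> 0 < t \<and> t < 1 / 3 \<and> deriv moebius_M t = 0"
proof -
  have "continuous_on {0..1/3} (deriv moebius_M)"
    by (intro continuous_at_imp_continuous_on ballI DERIV_isCont[OF has_derivative_deriv_moebius_M]) auto
  then obtain s where s: "0 \<le> s" "s \<le> 1 / 3" "deriv moebius_M s = 0"
    using IVT2'[of "deriv moebius_M" "1/3" 0 0] deriv_moebius_M_pos[of 0] deriv_moebius_M_third_neg by auto
  have s': "0 < s" "s < 1 / 3"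
  proof -
    have "s \<noteq> 0" using s deriv_moebius_M_pos[of 0] by (intro notI) simp
    moreover have "s \<noteq> 1 / 3" using s deriv_moebius_M_third_neg by (intro notI) simp
    ultimately show "0 < s" "s < 1 / 3" using s by simp_all
  qed
  have small: "smallest_zero_deriv_M s"
    unfolding smallest_zero_deriv_M_def
  proof (intro conjI ballI impI)
    fix x :: real assume "x \<in> {-1<..<1}" "deriv moebius_M x = 0"
    then show "\<bar>s\<bar> \<le> \<bar>x\<bar>"
      using deriv_moebius_M_zero_unique[of x s] s by (cases "\<bar>x\<bar> \<le> 1 / 3") auto
  qed (use s s' in auto)
  have uniq: "t = s" if "smallest_zero_deriv_M t" for t
  proof -
    have "\<bar>t\<bar> \<le> \<bar>s\<bar>" "deriv moebius_M t = 0" using that s s' by (auto simp: smallest_zero_deriv_M_def)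
    then show ?thesis using deriv_moebius_M_zero_unique[of t s] s by auto
  qed
  show "\<exists>!t. smallest_zero_deriv_M t" using small uniq by blast
  show "0 < t \<and> t < 1 / 3 \<and> deriv moebius_M t = 0" if "smallest_zero_deriv_M t"
    using uniq[OF that] s s' by simp
qed

section \<open>The Moebius series on circles\<close>

text \<open>The function M(z) / z with its removable singularity at 0 filled in.\<close>

definition moebius_quot :: "'a :: {banach, real_normed_field} \<Rightarrow> 'a" where
  "moebius_quot = eval_fps (fps_shift 1 moebius_series)"

lemma conv_radius_moebius_shift:
  "fps_conv_radius (fps_shift 1 (moebius_series :: 'a :: {banach, real_normed_field} fps)) \<ge> 1"
  using conv_radius_moebius_series by simp

lemma sums_moebius_quot:
  fixes z :: "'a :: {banach, real_normed_field}"
  assumes "norm z < 1"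
  shows "(\<lambda>n. of_int (moebius_mu (Suc n)) * z ^ n) sums moebius_quot z"
proof -
  have "ereal (norm z) < 1" using assms by simp
  also have "1 \<le> fps_conv_radius (fps_shift 1 (moebius_series :: 'a fps))"
    by (rule conv_radius_moebius_shift)
  finally have "(\<lambda>n. fps_nth (fps_shift 1 moebius_series) n * z ^ n) sums moebius_quot z"
    unfolding moebius_quot_def by (rule sums_eval_fps)
  then show ?thesis by simp
qed

lemma eval_moebius_series:
  fixes z :: "'a :: {banach, real_normed_field}"
  assumes "norm z < 1"
  shows "eval_fps moebius_series z = z * moebius_quot z"
proof -
  have "(\<lambda>n. z * (of_int (moebius_mu (Suc n)) * z ^ n)) sums (z * moebius_quot z)"
    by (intro sums_mult sums_moebius_quot assms)
  then have "(\<lambda>n. fps_nth moebius_series (Suc n) * z ^ Suc n) sums (z * moebius_quot z)"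
    by (simp add: mult_ac)
  then have "(\<lambda>n. fps_nth moebius_series n * z ^ n) sums (z * moebius_quot z)"
    by (subst (asm) sums_Suc_iff) (simp add: moebius_mu_values)
  then show ?thesis by (simp add: eval_fps_def sums_iff)
qed

text \<open>The constant term is 1 and the others are dominated by a geometric series of sum 1/2. So
  M has no zero but 0 in the closed disc of radius 1/3.\<close>

lemma norm_moebius_quot_diff_1_le:
  fixes z :: "'a :: {banach, real_normed_field}"
  assumes "norm z \<le> 1 / 3"
  shows "norm (moebius_quot z - 1) \<le> 1 / 2"
proof -
  have "(\<lambda>n. of_int (moebius_mu (Suc n)) * z ^ n) sums moebius_quot z"
    using assms by (intro sums_moebius_quot) auto
  then have "(\<lambda>n. of_int (moebius_mu (Suc (Suc n))) * z ^ Suc n) sums (moebius_quot z - 1)"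
    using moebius_mu_values(2) by (subst sums_Suc_iff) simp
  then have eq: "moebius_quot z - 1 = (\<Sum>n. of_int (moebius_mu (Suc (Suc n))) * z ^ Suc n)"
    by (simp add: sums_iff)
  have geo: "(\<lambda>n. (1 / 3) ^ Suc n :: real) sums (1 / 3 * (1 / (1 - 1 / 3)))"
    unfolding power_Suc by (intro sums_mult geometric_sums) simp
  have "norm (moebius_quot z - 1) \<le> (\<Sum>n. (1 / 3) ^ Suc n)"
    unfolding eq
  proof (rule norm_suminf_le)
    fix n
    have "norm z ^ Suc n \<le> (1 / 3) ^ Suc n" using assms by (intro power_mono) auto
    then have "norm (of_int (moebius_mu (Suc (Suc n))) :: 'a) * norm z ^ Suc n \<le> 1 * (1 / 3) ^ Suc n"
      using norm_of_int_moebius_mu_le_1[where ?'a = 'a, of "Suc (Suc n)"] by (intro mult_mono) auto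
    then show "norm (of_int (moebius_mu (Suc (Suc n))) * z ^ Suc n) \<le> (1 / 3) ^ Suc n"
      by (simp only: norm_mult norm_power mult_1)
  qed (use geo in \<open>simp add: sums_iff\<close>)
  also have "\<dots> = 1 / 2" using geo by (simp add: sums_iff)
  finally show ?thesis .
qed

lemma moebius_quot_nonzero:
  fixes z :: "'a :: {banach, real_normed_field}"
  assumes "norm z \<le> 1 / 3"
  shows "moebius_quot z \<noteq> 0"
  using norm_moebius_quot_diff_1_le[OF assms] by auto

lemma moebius_M_pos:
  assumes "0 < x" "x \<le> 1 / 3"
  shows "moebius_M x > 0"
proof -
  have "moebius_quot x > 0"
    using norm_moebius_quot_diff_1_le[of x] assms unfolding real_norm_def by linarith
  then show ?thesis using eval_moebius_series[of x] assms by (simp add: moebius_M_eq)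
qed

section \<open>Trigonometric inequalities\<close>

lemma abs_sin_of_nat_mult_le: "\<bar>sin (real n * x)\<bar> \<le> real n * \<bar>sin x\<bar>"
proof (induction n)
  case (Suc n)
  have "\<bar>sin (real (Suc n) * x)\<bar> = \<bar>sin (real n * x) * cos x + cos (real n * x) * sin x\<bar>"
    using sin_add[of "real n * x" x] by (simp add: distrib_right add.commute)
  also have "\<dots> \<le> \<bar>sin (real n * x)\<bar> * \<bar>cos x\<bar> + \<bar>cos (real n * x)\<bar> * \<bar>sin x\<bar>"
    by (simp add: abs_mult[symmetric])
  also have "\<dots> \<le> \<bar>sin (real n * x)\<bar> * 1 + 1 * \<bar>sin x\<bar>"
    by (intro add_mono mult_mono) auto
  finally show ?case using Suc by (simp add: distrib_right)
qed simp

text \<open>Half angles reduce this to the bound for sines. It makes high harmonics comparable with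
  \<open>1 - cos t\<close>.\<close>

lemma one_minus_cos_of_nat_mult_le: "1 - cos (real n * t) \<le> (real n)\<^sup>2 * (1 - cos t)"
proof -
  have *: "1 - cos u = 2 * (sin (u / 2))\<^sup>2" for u :: real
    using cos_double_sin[of "u / 2"] by simp
  have "(sin (real n * (t / 2)))\<^sup>2 \<le> (real n * \<bar>sin (t / 2)\<bar>)\<^sup>2"
    using power_mono[OF abs_sin_of_nat_mult_le[of n "t / 2"], of 2] by simp
  then show ?thesis using *[of "real n * t"] *[of t] by (simp add: power_mult_distrib mult_ac)
qed

lemma one_minus_cos_ge:
  assumes "\<bar>t\<bar> \<le> pi"
  shows "t\<^sup>2 / 6 \<le> 1 - cos t"
proof -
  \<comment> \<open>Halving the angle, as the Taylor bound at order 4 needs \<open>\<bar>u\<bar> \<le> 2\<close>.\<close>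
  define u where "u = t / 2"
  have u: "\<bar>u\<bar> \<le> pi / 2" using assms by (simp add: u_def)
  have "u\<^sup>2 / 3 \<le> 1 - cos u"
  proof -
    obtain v where v: "cos u = (\<Sum>m<4. cos_coeff m * u ^ m) + cos (v + 1 / 2 * real 4 * pi) / fact 4 * u ^ 4"
      using Maclaurin_cos_expansion[of u 4] by blast
    have "cos u \<le> (\<Sum>m<4. cos_coeff m * u ^ m) + 1 / fact 4 * u ^ 4"
      unfolding v by (intro add_left_mono mult_right_mono divide_right_mono) auto
    moreover have "(\<Sum>m<4. cos_coeff m * u ^ m) = 1 - u\<^sup>2 / 2"
    proof -
      have "{..<4} = {0, 1, 2, 3 :: nat}" by auto
      then show ?thesis by (simp add: cos_coeff_def)
    qed
    ultimately have c: "cos u \<le> 1 - u\<^sup>2 / 2 + u ^ 4 / 24" by (simp add: fact_numeral)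
    have "\<bar>u\<bar> \<le> 2" using u pi_half_less_two by linarith
    then have "\<bar>u\<bar>\<^sup>2 \<le> 2\<^sup>2" by (intro power_mono) auto
    then have "u\<^sup>2 \<le> 4" by simp
    then have "u\<^sup>2 * u\<^sup>2 \<le> 4 * u\<^sup>2" by (intro mult_right_mono) auto
    moreover have "u ^ 4 = u\<^sup>2 * u\<^sup>2" by (simp flip: power_add)
    ultimately have "u ^ 4 \<le> 4 * u\<^sup>2" by (simp only:)
    then show ?thesis using c by linarith
  qed
  moreover have "cos u \<ge> 0" using u by (intro cos_ge_zero) auto
  \<comment> \<open>\<open>P\<close> is the square of \<open>sin u\<close>; as
    \<open>cos u \<ge> 0\<close>, it is at least \<open>1 - cos u\<close>.\<close>
  define P where "P = (1 - cos u) * (1 + cos u)"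
  have "(1 - cos u) * 1 \<le> P" unfolding P_def using \<open>cos u \<ge> 0\<close> by (intro mult_left_mono) auto
  then have "1 - cos u \<le> P" by simp
  moreover have "1 - cos t = 2 * P"
    using cos_double_cos[of "t / 2"] by (simp add: P_def u_def power2_eq_square algebra_simps)
  moreover have "t\<^sup>2 = 4 * u\<^sup>2" by (simp add: u_def power2_eq_square)
  ultimately show ?thesis by linarith
qed

text \<open>Term \<open>n\<close> of the difference is
  \<open>moebius_mu (Suc n) * x ^ n * (cos (real n * t) - 1)\<close>. For \<open>n = 1\<close> it is
  \<open>x * (1 - cos t)\<close>, for 2, 3 and 4 it is nonnegative, and the tail uses up less than
  3/4 of the first term.\<close>

lemma Re_moebius_quot_ge:
  assumes x: "0 < x" "x \<le> 1 / 3"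
  shows "Re (moebius_quot (of_real x * cis t)) \<ge> moebius_quot x + x / 4 * (1 - cos t)"
proof -
  define f where "f n = of_int (moebius_mu (Suc n)) * x ^ n * (cos (real n * t) - 1)" for n
  have nz: "norm (of_real x * cis t) < 1" using x by (simp add: norm_mult)
  have pow: "Re (of_int (moebius_mu (Suc n)) * (of_real x * cis t) ^ n) =
      of_int (moebius_mu (Suc n)) * x ^ n * cos (real n * t)" for n
  proof -
    have "of_int (moebius_mu (Suc n)) * (of_real x * cis t) ^ n =
        of_real (of_int (moebius_mu (Suc n)) * x ^ n) * cis (real n * t)"
      by (simp add: power_mult_distrib Complex.DeMoivre)
    then show ?thesis by (simp del: of_real_mult of_real_power of_real_of_int_eq)
  qed
  have "(\<lambda>n. of_int (moebius_mu (Suc n)) * x ^ n * cos (real n * t)) sums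
      Re (moebius_quot (of_real x * cis t))"
    using sums_Re[OF sums_moebius_quot[OF nz]] unfolding pow .
  then have "(\<lambda>n. of_int (moebius_mu (Suc n)) * x ^ n * cos (real n * t) -
      of_int (moebius_mu (Suc n)) * x ^ n) sums
      (Re (moebius_quot (of_real x * cis t)) - moebius_quot x)"
    using x by (intro sums_diff sums_moebius_quot) auto
  then have "f sums (Re (moebius_quot (of_real x * cis t)) - moebius_quot x)"
    by (simp add: f_def[abs_def] algebra_simps)
  then have fs: "(\<lambda>m. f (Suc m)) sums (Re (moebius_quot (of_real x * cis t)) - moebius_quot x)"
    by (subst sums_Suc_iff) (simp add: f_def)
  \<comment> \<open>Chosen so that \<open>d 0 = 1\<close> and \<open>d 1 = d 2 = d 3 = 0\<close>,
    while from 4 on \<open>d m\<close> is minus the majorant. The sum of \<open>d\<close> is 35 /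
    108.\<close>
  define c :: "nat \<Rightarrow> real" where
    "c m = (if m = 0 then 3 else if m = 1 then 2 else if m = 2 then 4 / 3 else 20 / 27)" for m
  define d where "d m = (if m \<in> {..<4} then c m else 0) - real (m + 1) * real (m + 2) / 3 ^ m" for m
  have "(\<lambda>m. if m \<in> {..<4} then c m else 0) sums (\<Sum>m<4. c m)" by (rule sums_If_finite_set) simp
  then have "d sums ((\<Sum>m<4. c m) - 27 / 4)"
    unfolding d_def using sums_quadratic_thirds by (rule sums_diff)
  then have ds: "(\<lambda>m. x * (1 - cos t) * d m) sums (x * (1 - cos t) * ((\<Sum>m<4. c m) - 27 / 4))"
    by (rule sums_mult)
  have "x * (1 - cos t) * ((\<Sum>m<4. c m) - 27 / 4) \<le> Re (moebius_quot (of_real x * cis t)) - moebius_quot x"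
  proof (rule sums_le[OF _ ds fs])
    fix m :: nat
    have nonneg: "0 \<le> x * (1 - cos t)" using x by simp
    consider "m = 0" | "m = 1" | "m = 2" | "m = 3" | "4 \<le> m" by linarith
    then show "x * (1 - cos t) * d m \<le> f (Suc m)"
    proof cases
      case 1
      then show ?thesis using moebius_mu_values(3)[unfolded numeral_2_eq_2]
        by (simp add: f_def d_def c_def algebra_simps)
    next
      case 2
      have "0 \<le> x ^ 2 * (1 - cos (2 * t))" using x by (intro mult_nonneg_nonneg) auto
      moreover have "f (Suc m) = x ^ 2 * (1 - cos (2 * t))"
        using moebius_mu_values(4)[unfolded numeral_3_eq_3] 2
        by (simp add: f_def numeral_2_eq_2 algebra_simps)
      ultimately show ?thesis using 2 by (simp add: d_def c_def)
    next
      case 3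
      have "f (Suc m) = 0" using moebius_mu_values(5) 3 by (simp add: f_def)
      then show ?thesis using 3 by (simp add: d_def c_def)
    next
      case 4
      have "0 \<le> x ^ 4 * (1 - cos (4 * t))" using x by (intro mult_nonneg_nonneg) auto
      moreover have "f (Suc m) = x ^ 4 * (1 - cos (4 * t))"
        using moebius_mu_values(6) 4 by (simp add: f_def algebra_simps)
      ultimately show ?thesis using 4 by (simp add: d_def c_def)
    next
      case 5
      have "- f (Suc m) \<le> \<bar>of_int (moebius_mu (Suc (Suc m)))\<bar> * (x * x ^ m) * (1 - cos (real (Suc m) * t))"
      proof -
        have "- f (Suc m) \<le> \<bar>f (Suc m)\<bar>" by simp
        also have "\<dots> = \<bar>of_int (moebius_mu (Suc (Suc m)))\<bar> * (x * x ^ m) * (1 - cos (real (Suc m) * t))"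
          using x by (simp add: f_def abs_mult abs_of_nonpos del: of_nat_Suc)
        finally show ?thesis .
      qed
      also have "\<dots> \<le> 1 * (x * (1 / 3) ^ m) * ((real (Suc m))\<^sup>2 * (1 - cos t))"
        using x abs_moebius_mu_le_1[of "Suc (Suc m)"] one_minus_cos_of_nat_mult_le[of "Suc m" t]
        by (intro mult_mono power_mono) (auto simp: mult_nonneg_nonneg simp del: of_nat_Suc)
      also have "\<dots> = x * (1 - cos t) * ((real (m + 1) * real (m + 1)) / 3 ^ m)"
        by (simp add: power2_eq_square power_one_over)
      \<comment> \<open>The square is weakened in order to reuse
        \<open>sums_quadratic_thirds\<close>.\<close>
      also have "\<dots> \<le> x * (1 - cos t) * ((real (m + 1) * real (m + 2)) / 3 ^ m)"
        using nonneg by (intro mult_left_mono divide_right_mono) auto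
      also have "\<dots> = - (x * (1 - cos t) * d m)" using 5 by (simp add: d_def)
      finally show ?thesis by simp
    qed
  qed
  moreover have "(\<Sum>m<4. c m) - 27 / 4 \<ge> 1 / 4" by (simp add: c_def lessThan_nat_numeral)
  then have "x * (1 - cos t) * (1 / 4) \<le> x * (1 - cos t) * ((\<Sum>m<4. c m) - 27 / 4)"
    using x by (intro mult_left_mono) auto
  ultimately have "x * (1 - cos t) * (1 / 4) \<le> Re (moebius_quot (of_real x * cis t)) - moebius_quot x"
    by (rule order_trans[rotated])
  then show ?thesis by simp
qed

text \<open>The modulus is \<open>x\<close> times that of \<open>moebius_quot\<close>, which is at
  least its real part.\<close>

lemma norm_moebius_series_circle_ge:
  assumes x: "0 < x" "x \<le> 1 / 3"
  shows "norm (eval_fps moebius_series (of_real x * cis t)) \<ge> moebius_M x + x\<^sup>2 / 4 * (1 - cos t)"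
proof -
  have "moebius_M x + x\<^sup>2 / 4 * (1 - cos t) = x * (moebius_quot x + x / 4 * (1 - cos t))"
    using x eval_moebius_series[of x] by (simp add: moebius_M_eq power2_eq_square algebra_simps)
  also have "\<dots> \<le> x * norm (moebius_quot (of_real x * cis t))"
    using x by (intro mult_left_mono order_trans[OF Re_moebius_quot_ge[OF x] complex_Re_le_cmod]) simp
  also have "\<dots> = norm (eval_fps moebius_series (of_real x * cis t))"
    using x by (subst eval_moebius_series) (auto simp: norm_mult)
  finally show ?thesis .
qed

section \<open>Laplace's method\<close>

text \<open>A multiple of the normal density of variance \<open>1 / (2 * \<beta>)\<close>.\<close>

lemma has_bochner_integral_gaussian:
  assumes "\<beta> > 0"
  shows "has_bochner_integral lborel (\<lambda>s :: real. exp (- \<beta> * s\<^sup>2)) (sqrt (pi / \<beta>))"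
proof -
  define \<sigma> where "\<sigma> = sqrt (1 / (2 * \<beta>))"
  have \<sigma>: "\<sigma> > 0" "\<sigma>\<^sup>2 = 1 / (2 * \<beta>)" using assms by (simp_all add: \<sigma>_def)
  have "has_bochner_integral lborel (\<lambda>s. normal_density 0 \<sigma> s) 1"
    using normal_moment_even[OF \<sigma>(1), of 0 0] by simp
  then have "has_bochner_integral lborel (\<lambda>s. sqrt (pi / \<beta>) * normal_density 0 \<sigma> s) (sqrt (pi / \<beta>) * 1)"
    by (intro has_bochner_integral_mult_right)
  moreover have "sqrt (pi / \<beta>) * normal_density 0 \<sigma> s = exp (- \<beta> * s\<^sup>2)" for s
  proof -
    have "2 * pi * \<sigma>\<^sup>2 = pi / \<beta>" "- (s - 0)\<^sup>2 / (2 * \<sigma>\<^sup>2) = - \<beta> * s\<^sup>2"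
      using assms unfolding \<sigma>(2) by (simp_all add: field_simps)
    then have "normal_density 0 \<sigma> s = 1 / sqrt (pi / \<beta>) * exp (- \<beta> * s\<^sup>2)"
      unfolding normal_density_def by (simp only:)
    then show ?thesis using assms by simp
  qed
  ultimately show ?thesis by simp
qed

text \<open>\<open>W\<close> is compared with a Gaussian \<open>E\<close>, whose powers at the
  scaled points do not depend on \<open>k\<close>. Both moduli are eventually at most 1, so the
  powers differ by at most \<open>Suc k\<close> times the difference of the bases, and this tends to
  0 because \<open>W\<close> and \<open>E\<close> agree to second order. Complex logarithms are thus
  avoided.\<close>

lemma laplace_pointwise:
  fixes W :: "real \<Rightarrow> complex"
  assumes \<alpha>: "\<alpha> > 0" and bound: "\<And>t. \<bar>t\<bar> \<le> pi \<Longrightarrow> norm (W t) \<le> exp (- \<alpha> * t\<^sup>2)"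
    and W0: "W 0 = 1"
    and \<beta>: "\<beta> > 0" and lim: "((\<lambda>t. (W t - 1) / of_real (t\<^sup>2)) \<longlongrightarrow> - of_real \<beta>) (at 0)"
  shows "(\<lambda>k. W (s / sqrt (real (Suc k))) ^ Suc k) \<longlonglongrightarrow> of_real (exp (- \<beta> * s\<^sup>2))"
proof (cases "s = 0")
  case True
  then show ?thesis using W0 by simp
next
  case False
  define u where "u k = s / sqrt (real (Suc k))" for k
  have "u \<longlonglongrightarrow> 0" unfolding u_def by real_asymp
  have u0: "u k \<noteq> 0" for k using False by (simp add: u_def)
  have u2: "real (Suc k) * (u k)\<^sup>2 = s\<^sup>2" for k
    by (simp add: u_def power_divide del: of_nat_Suc)
  have filt: "filterlim u (at 0) sequentially"
    using \<open>u \<longlonglongrightarrow> 0\<close> u0 by (simp add: filterlim_at)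
  define E :: "real \<Rightarrow> complex" where "E t = of_real (exp (- \<beta> * t\<^sup>2))" for t
  have "((\<lambda>t :: real. (exp (- \<beta> * t\<^sup>2) - 1) / t\<^sup>2) \<longlongrightarrow> - \<beta>) (at 0)"
    using \<beta> by real_asymp
  then have "((\<lambda>t :: real. of_real ((exp (- \<beta> * t\<^sup>2) - 1) / t\<^sup>2) :: complex) \<longlongrightarrow> of_real (- \<beta>)) (at 0)"
    by (rule tendsto_of_real)
  then have "((\<lambda>t. (E t - 1) / of_real (t\<^sup>2)) \<longlongrightarrow> - of_real \<beta>) (at 0)"
    by (simp add: E_def)
  then have "((\<lambda>t. (W t - 1) / of_real (t\<^sup>2) - (E t - 1) / of_real (t\<^sup>2)) \<longlongrightarrow> - of_real \<beta> - - of_real \<beta>) (at 0)"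
    using lim by (intro tendsto_diff)
  then have "((\<lambda>t. (W t - E t) / of_real (t\<^sup>2)) \<longlongrightarrow> 0) (at 0)"
    by (simp add: diff_divide_distrib)
  then have "(\<lambda>k. (W (u k) - E (u k)) / of_real ((u k)\<^sup>2)) \<longlonglongrightarrow> 0"
    using filt by (rule filterlim_compose)
  then have z: "(\<lambda>k. s\<^sup>2 * norm ((W (u k) - E (u k)) / of_real ((u k)\<^sup>2))) \<longlonglongrightarrow> 0"
    by (intro tendsto_mult_right_zero tendsto_norm_zero)
  have ev: "eventually (\<lambda>k. \<bar>u k\<bar> < pi) sequentially"
    using tendsto_rabs_zero[OF \<open>u \<longlonglongrightarrow> 0\<close>] by (rule order_tendstoD) simp
  have "(\<lambda>k. W (u k) ^ Suc k - E (u k) ^ Suc k) \<longlonglongrightarrow> 0"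
  proof (rule Lim_null_comparison[OF _ z])
    show "eventually (\<lambda>k. norm (W (u k) ^ Suc k - E (u k) ^ Suc k) \<le>
        s\<^sup>2 * norm ((W (u k) - E (u k)) / of_real ((u k)\<^sup>2))) sequentially"
      using ev
    proof eventually_elim
      case (elim k)
      have "norm (W (u k)) \<le> exp (- \<alpha> * (u k)\<^sup>2)" using elim by (intro bound) simp
      also have "\<dots> \<le> 1" using \<alpha> by simp
      finally have "norm (W (u k)) \<le> 1" .
      moreover have "norm (E (u k)) \<le> 1" using \<beta> by (simp add: E_def)
      ultimately have "norm (W (u k) ^ Suc k - E (u k) ^ Suc k) \<le> real (Suc k) * norm (W (u k) - E (u k))"
        by (rule norm_power_diff)
      also have "\<dots> = s\<^sup>2 * norm ((W (u k) - E (u k)) / of_real ((u k)\<^sup>2))"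
        using u0[of k] unfolding u2[of k, symmetric] by (simp add: norm_divide norm_power)
      finally show ?case .
    qed
  qed
  moreover have "E (u k) ^ Suc k = of_real (exp (- \<beta> * s\<^sup>2))" for k
  proof -
    have "exp (- \<beta> * (u k)\<^sup>2) ^ Suc k = exp (real (Suc k) * (- \<beta> * (u k)\<^sup>2))"
      by (rule exp_of_nat_mult[symmetric])
    also have "real (Suc k) * (- \<beta> * (u k)\<^sup>2) = - \<beta> * s\<^sup>2"
      unfolding u2[of k, symmetric] by (simp only: mult_ac)
    finally show ?thesis by (simp only: E_def of_real_power[symmetric])
  qed
  ultimately have "(\<lambda>k. W (u k) ^ Suc k - of_real (exp (- \<beta> * s\<^sup>2))) \<longlonglongrightarrow> 0" by simp
  then show ?thesis unfolding u_def by (simp only: LIM_zero_iff)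
qed

text \<open>Under \<open>t = s / sqrt k\<close> the integrand tends pointwise to a Gaussian. The
  bound on \<open>W\<close> holds on the whole interval and is itself Gaussian, so after the scaling
  it is one majorant for all \<open>k\<close>.\<close>

lemma laplace_method:
  fixes W \<phi> :: "real \<Rightarrow> complex"
  assumes contW: "continuous_on UNIV W" and cont\<phi>: "continuous_on UNIV \<phi>"
    and \<alpha>: "\<alpha> > 0" and bound: "\<And>t. \<bar>t\<bar> \<le> pi \<Longrightarrow> norm (W t) \<le> exp (- \<alpha> * t\<^sup>2)"
    and W0: "W 0 = 1"
    and \<beta>: "\<beta> > 0" and lim: "((\<lambda>t. (W t - 1) / of_real (t\<^sup>2)) \<longlongrightarrow> - of_real \<beta>) (at 0)"
  shows "(\<lambda>k. sqrt (real k) *\<^sub>R (\<integral>t. indicator {-pi..pi} t *\<^sub>R (\<phi> t * W t ^ k) \<partial>lborel))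
           \<longlonglongrightarrow> \<phi> 0 * of_real (sqrt (pi / \<beta>))"
proof -
  have "compact (\<phi> ` {-pi..pi})"
    using cont\<phi> by (intro compact_continuous_image continuous_on_subset[OF cont\<phi>]) auto
  then obtain B where B: "\<And>t. t \<in> {-pi..pi} \<Longrightarrow> norm (\<phi> t) \<le> B"
    using compact_imp_bounded bounded_iff by (metis imageI)
  define f where "f k t = indicator {-pi..pi} t *\<^sub>R (\<phi> t * W t ^ k)" for k t
  have [measurable]: "W \<in> borel_measurable borel" "\<phi> \<in> borel_measurable borel"
    using contW cont\<phi> by (auto intro: borel_measurable_continuous_onI)
  have fm[measurable]: "f k \<in> borel_measurable borel" for k unfolding f_def by measurable
  have scale: "sqrt (real (Suc k)) *\<^sub>R (\<integral>t. f (Suc k) t \<partial>lborel) =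
      (\<integral>s. f (Suc k) (s / sqrt (real (Suc k))) \<partial>lborel)" for k
    using lborel_integral_real_affine[of "1 / sqrt (real (Suc k))" "f (Suc k)" 0]
    by (simp del: of_nat_Suc)
  have "(\<lambda>k. \<integral>s. f (Suc k) (s / sqrt (real (Suc k))) \<partial>lborel) \<longlonglongrightarrow>
      (\<integral>s. \<phi> 0 * of_real (exp (- \<beta> * s\<^sup>2)) \<partial>lborel)"
  proof (rule integral_dominated_convergence[where w = "\<lambda>s. B * exp (- \<alpha> * s\<^sup>2)"])
    show "integrable lborel (\<lambda>s. B * exp (- \<alpha> * s\<^sup>2))"
      using has_bochner_integral_gaussian[OF \<alpha>] by (intro integrable_mult_right) (rule integrable.intros)
    show "AE s in lborel. norm (f (Suc k) (s / sqrt (real (Suc k)))) \<le> B * exp (- \<alpha> * s\<^sup>2)" for k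
    proof (rule AE_I2)
      fix s
      let ?u = "s / sqrt (real (Suc k))"
      show "norm (f (Suc k) ?u) \<le> B * exp (- \<alpha> * s\<^sup>2)"
      proof (cases "?u \<in> {-pi..pi}")
        case True
        have "norm (W ?u) ^ Suc k \<le> exp (- \<alpha> * ?u\<^sup>2) ^ Suc k"
          using True by (intro power_mono bound) auto
        also have "\<dots> = exp (real (Suc k) * (- \<alpha> * ?u\<^sup>2))" by (rule exp_of_nat_mult[symmetric])
        also have "real (Suc k) * (- \<alpha> * ?u\<^sup>2) = - \<alpha> * s\<^sup>2"
          by (simp add: power_divide del: of_nat_Suc)
        finally have "norm (\<phi> ?u) * norm (W ?u) ^ Suc k \<le> B * exp (- \<alpha> * s\<^sup>2)"
          using B[OF True] by (intro mult_mono) (auto intro: order_trans[OF norm_ge_zero])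
        then show ?thesis using True by (simp only: f_def indicator_simps scaleR_one norm_mult norm_power)
      next
        case False
        have "0 \<le> B" using B[of 0] by (auto intro: order_trans[OF norm_ge_zero])
        then show ?thesis using False by (simp add: f_def)
      qed
    qed
    show "AE s in lborel. (\<lambda>k. f (Suc k) (s / sqrt (real (Suc k)))) \<longlonglongrightarrow> \<phi> 0 * of_real (exp (- \<beta> * s\<^sup>2))"
    proof (rule AE_I2)
      fix s
      have u: "(\<lambda>k. s / sqrt (real (Suc k))) \<longlonglongrightarrow> 0" by real_asymp
      have ev: "eventually (\<lambda>k. \<bar>s / sqrt (real (Suc k))\<bar> < pi) sequentially"
        using tendsto_rabs_zero[OF u] by (rule order_tendstoD) simp
      have "isCont \<phi> 0" using cont\<phi> by (simp add: continuous_on_eq_continuous_at)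
      then have "(\<lambda>k. \<phi> (s / sqrt (real (Suc k)))) \<longlonglongrightarrow> \<phi> 0" using u by (rule isCont_tendsto_compose)
      then have "(\<lambda>k. \<phi> (s / sqrt (real (Suc k))) * W (s / sqrt (real (Suc k))) ^ Suc k)
          \<longlonglongrightarrow> \<phi> 0 * of_real (exp (- \<beta> * s\<^sup>2))"
        by (intro tendsto_mult laplace_pointwise[OF \<alpha> bound W0 \<beta> lim])
      moreover have "eventually (\<lambda>k. \<phi> (s / sqrt (real (Suc k))) * W (s / sqrt (real (Suc k))) ^ Suc k =
          f (Suc k) (s / sqrt (real (Suc k)))) sequentially"
        using ev
      proof eventually_elim
        case (elim k)
        then have "s / sqrt (real (Suc k)) \<in> {-pi..pi}" unfolding atLeastAtMost_iff by linarith
        then show ?case by (simp only: f_def indicator_simps scaleR_one)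
      qed
      ultimately show "(\<lambda>k. f (Suc k) (s / sqrt (real (Suc k)))) \<longlonglongrightarrow> \<phi> 0 * of_real (exp (- \<beta> * s\<^sup>2))"
        by (rule Lim_transform_eventually)
    qed
  qed measurable
  moreover have "(\<integral>s. \<phi> 0 * of_real (exp (- \<beta> * s\<^sup>2)) \<partial>lborel) = \<phi> 0 * of_real (sqrt (pi / \<beta>))"
    using has_bochner_integral_gaussian[OF \<beta>, THEN has_bochner_integral_integral_eq] by simp
  ultimately have "(\<lambda>k. sqrt (real (Suc k)) *\<^sub>R (\<integral>t. f (Suc k) t \<partial>lborel)) \<longlonglongrightarrow> \<phi> 0 * of_real (sqrt (pi / \<beta>))"
    unfolding scale by (simp only:)
  then have "(\<lambda>k. sqrt (real k) *\<^sub>R (\<integral>t. f k t \<partial>lborel)) \<longlonglongrightarrow> \<phi> 0 * of_real (sqrt (pi / \<beta>))"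
    by (rule LIMSEQ_imp_Suc)
  then show ?thesis by (simp add: f_def)
qed

section \<open>Coefficients as integrals over a circle\<close>

text \<open>Starting at \<open>- pi\<close> puts the point \<open>r\<close>, where the integrand
  will peak, in the middle at \<open>t = 0\<close>; integrals along a closed path do not depend on
  its starting point.\<close>

lemma part_circlepath_eq_shiftpath: "part_circlepath 0 r (- pi) pi = shiftpath (1 / 2) (circlepath 0 r)"
proof
  fix x :: real
  have part: "part_circlepath 0 r a b y = of_real r * cis (linepath a b y)" for a b y
    unfolding part_circlepath_def cis_conv_exp by (rule add_0)
  have "linepath (- pi) pi x = 2 * pi * x - pi" by (simp add: linepath_def algebra_simps)
  then have lhs: "part_circlepath 0 r (- pi) pi x = of_real r * cis (2 * pi * x - pi)"
    by (simp only: part)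
  have "linepath 0 (2 * pi) y = 2 * pi * y" for y by (simp add: linepath_def)
  then have circ: "circlepath 0 r y = of_real r * cis (2 * pi * y)" for y
    by (simp only: circlepath_def part)
  have "cis (2 * pi * (1 / 2 + x)) = cis (2 * pi * x - pi)"
  proof -
    have "2 * pi * (1 / 2 + x) = (2 * pi * x - pi) + 2 * pi" by (simp add: algebra_simps)
    then show ?thesis by (simp only: cis_mult[symmetric] cis_2pi mult_1_right)
  qed
  moreover have "2 * pi * (1 / 2 + x - 1) = 2 * pi * x - pi" by (simp add: algebra_simps)
  ultimately show "part_circlepath 0 r (- pi) pi x = shiftpath (1 / 2) (circlepath 0 r) x"
    unfolding lhs shiftpath_def circ by (simp only: if_cancel)
qed

lemma holomorphic_moebius_quot: "(moebius_quot :: complex \<Rightarrow> complex) holomorphic_on ball 0 1"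
  unfolding moebius_quot_def
proof (rule holomorphic_on_eval_fps)
  have "ball 0 1 = eball (0 :: complex) 1" using eball_ereal[of 0 1] by (simp add: one_ereal_def)
  also have "\<dots> \<subseteq> eball (0 :: complex) (fps_conv_radius (fps_shift 1 (moebius_series :: complex fps)))"
    by (rule eball_mono[OF conv_radius_moebius_shift])
  finally show "ball 0 1 \<subseteq> eball (0 :: complex) (fps_conv_radius (fps_shift 1 (moebius_series :: complex fps)))" .
qed

lemma continuous_moebius_circle:
  assumes "\<bar>r\<bar> < 1"
  shows "continuous_on UNIV (\<lambda>t. eval_fps moebius_series (of_real r * cis t))"
proof -
  have "continuous_on (ball 0 1) (eval_fps (moebius_series :: complex fps))"
  proof (intro continuous_at_imp_continuous_on ballI)
    fix z :: complex assume "z \<in> ball 0 1"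
    then show "isCont (eval_fps moebius_series) z"
      using DERIV_isCont[OF has_field_derivative_moebius_derivs[of z 0 UNIV]] by simp
  qed
  moreover have "continuous_on UNIV (\<lambda>t. of_real r * cis t)" by (intro continuous_intros)
  ultimately show ?thesis
    by (rule continuous_on_compose2) (use assms in \<open>auto simp: norm_mult\<close>)
qed

lemma moebius_circle_nonzero:
  assumes "0 < r" "r \<le> 1 / 3"
  shows "eval_fps moebius_series (of_real r * cis t) \<noteq> (0 :: complex)"
proof -
  have "norm (of_real r * cis t) = r" using assms by (simp add: norm_mult)
  then show ?thesis
    using assms moebius_quot_nonzero[of "of_real r * cis t"] eval_moebius_series[of "of_real r * cis t"]
    by simp
qed

text \<open>Lagrange inversion leads to coefficient \<open>k - 1\<close> of (z / M(z))^k, which by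
  Cauchy's formula is an integral of 1 / M(z)^k over the circle; dz = i z dt supplies the factor
  \<open>of_real r * cis t\<close>. Below radius 1/3 there is no zero of M but 0.\<close>

lemma system_fps_nth_integral:
  assumes r: "0 < r" "r < 1 / 3" and k: "k \<ge> 1"
  shows "of_nat k * system_fps $ k = of_real (1 / (2 * pi)) *
    (\<integral>t. indicator {-pi..pi} t *\<^sub>R
       (of_real r * cis t / eval_fps moebius_series (of_real r * cis t) ^ k) \<partial>lborel)"
proof -
  let ?g = "fps_shift 1 moebius_series :: complex fps"
  let ?M = "\<lambda>t. eval_fps moebius_series (of_real r * cis t) :: complex"
  \<comment> \<open>This is (z / M(z))^k, without a singularity at 0.\<close>
  define H where "H z = inverse (moebius_quot z) ^ k" for z :: complex
  have g0: "?g $ 0 \<noteq> 0" using moebius_mu_values by simp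
  have Xg: "fps_X * ?g = moebius_series"
    by (rule fps_ext) (simp add: fps_X_mult_nth moebius_mu_values split: nat.split)
  have "system_fps oo moebius_series = (fps_X :: complex fps)"
    unfolding system_fps_eq_fps_inv moebius_series_def by (rule fps_inv) (simp_all add: moebius_mu_def)
  then have "system_fps oo (fps_X * ?g) = fps_X" unfolding Xg .
  then have lagrange: "of_nat k * system_fps $ k = (inverse ?g ^ k) $ (k - 1)"
    by (rule fps_lagrange_inversion[OF g0 _ k])
  have "fps_conv_radius ?g > 0"
    by (rule less_le_trans[OF _ conv_radius_moebius_shift]) simp
  then have "moebius_quot has_fps_expansion ?g"
    unfolding moebius_quot_def by (rule eval_fps_has_fps_expansion)
  then have "H has_fps_expansion inverse ?g ^ k"
    unfolding H_def by (intro has_fps_expansion_power has_fps_expansion_inverse g0)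
  then have coeff: "(inverse ?g ^ k) $ (k - 1) = (deriv ^^ (k - 1)) H 0 / fact (k - 1)"
    by (rule fps_nth_fps_expansion)
  have hol: "H holomorphic_on ball 0 (1 / 3)"
  proof -
    have "moebius_quot z \<noteq> 0" if "z \<in> ball 0 (1 / 3)" for z :: complex
      using that by (intro moebius_quot_nonzero) simp
    then show ?thesis
      unfolding H_def
      by (intro holomorphic_intros holomorphic_on_subset[OF holomorphic_moebius_quot]) auto
  qed
  have cauchy: "((\<lambda>u. H u / (u - 0) ^ Suc (k - 1)) has_contour_integral
      (2 * pi * \<i>) / fact (k - 1) * (deriv ^^ (k - 1)) H 0) (circlepath 0 r)"
    using r by (intro Cauchy_has_contour_integral_higher_derivative_circlepath
        holomorphic_on_imp_continuous_on holomorphic_on_subset[OF hol]) auto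
  have "((\<lambda>u. H u / u ^ k) has_contour_integral (2 * pi * \<i>) * (of_nat k * system_fps $ k)) (circlepath 0 r)"
  proof -
    have "(2 * pi * \<i>) / fact (k - 1) * (deriv ^^ (k - 1)) H 0 = (2 * pi * \<i>) * (of_nat k * system_fps $ k)"
      unfolding lagrange coeff by simp
    moreover have "Suc (k - 1) = k" using k by simp
    ultimately show ?thesis using cauchy by (simp only: diff_zero)
  qed
  then have "((\<lambda>u. H u / u ^ k) has_contour_integral (2 * pi * \<i>) * (of_nat k * system_fps $ k))
      (part_circlepath 0 r (- pi) pi)"
    unfolding part_circlepath_eq_shiftpath by (rule has_contour_integral_shiftpath) auto
  then have "((\<lambda>t. H (0 + of_real r * cis t) / (0 + of_real r * cis t) ^ k * of_real r * \<i> * cis t) has_integral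
      (2 * pi * \<i>) * (of_nat k * system_fps $ k)) {-pi..pi}"
    by (rule iffD1[OF has_contour_integral_part_circlepath_iff, rotated]) simp
  moreover have "H (0 + of_real r * cis t) / (0 + of_real r * cis t) ^ k * of_real r * \<i> * cis t
      = \<i> * (of_real r * cis t / ?M t ^ k)" for t
  proof -
    have "norm (of_real r * cis t) < 1" using r by (simp add: norm_mult)
    then have "?M t = of_real r * cis t * moebius_quot (of_real r * cis t)" by (rule eval_moebius_series)
    then show ?thesis
      by (simp only: add_0 H_def power_mult_distrib power_inverse divide_inverse inverse_mult_distrib mult_ac)
  qed
  ultimately have int: "((\<lambda>t. \<i> * (of_real r * cis t / ?M t ^ k)) has_integral
      (2 * pi * \<i>) * (of_nat k * system_fps $ k)) {-pi..pi}" by (simp only:)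
  have "?M t ^ k \<noteq> 0" for t using moebius_circle_nonzero[of r t] r by simp
  \<comment> \<open>Continuity lets the gauge integral be read as a Lebesgue integral, to which
    dominated convergence applies.\<close>
  then have "continuous_on {-pi..pi} (\<lambda>t. \<i> * (of_real r * cis t / ?M t ^ k))"
    using r by (intro continuous_intros continuous_on_subset[OF continuous_moebius_circle]) simp_all
  then have "set_integrable lborel {-pi..pi} (\<lambda>t. \<i> * (of_real r * cis t / ?M t ^ k))"
    by (rule borel_integrable_atLeastAtMost')
  then have "(LINT t:{-pi..pi}|lborel. \<i> * (of_real r * cis t / ?M t ^ k)) =
      integral {-pi..pi} (\<lambda>t. \<i> * (of_real r * cis t / ?M t ^ k))"
    by (rule set_borel_integral_eq_integral)
  also have "\<dots> = (2 * pi * \<i>) * (of_nat k * system_fps $ k)" by (rule integral_unique[OF int])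
  finally have "\<i> * (LINT t:{-pi..pi}|lborel. of_real r * cis t / ?M t ^ k) =
      \<i> * (of_real (2 * pi) * (of_nat k * system_fps $ k))"
    unfolding set_integral_mult_right by (simp only: of_real_mult mult_ac)
  then have "(LINT t:{-pi..pi}|lborel. of_real r * cis t / ?M t ^ k) =
      of_real (2 * pi) * (of_nat k * system_fps $ k)"
    unfolding mult_cancel_left by (simp only: complex_i_not_zero simp_thms)
  moreover have "of_real (1 / (2 * pi)) * (of_real (2 * pi) * x) = x" for x :: complex
    by simp
  ultimately show ?thesis unfolding set_lebesgue_integral_def by (simp only:)
qed

section \<open>Second-order expansion at the critical point\<close>

lemma fps_nth_moebius_derivs_of_real:
  "fps_nth ((fps_deriv ^^ j) moebius_series) n =
     (of_real (fps_nth ((fps_deriv ^^ j) moebius_series) n) :: complex)"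
  by (induction j arbitrary: n) (simp_all del: of_nat_Suc)

lemma eval_moebius_derivs_of_real:
  assumes "\<bar>x\<bar> < 1"
  shows "eval_fps ((fps_deriv ^^ j) moebius_series) (of_real x) =
    (of_real (eval_fps ((fps_deriv ^^ j) moebius_series) x) :: complex)"
proof -
  have "ereal (norm x) < 1" using assms by simp
  also have "1 \<le> fps_conv_radius ((fps_deriv ^^ j) (moebius_series :: real fps))"
    by (rule conv_radius_moebius_derivs)
  finally have "(\<lambda>n. of_real (fps_nth ((fps_deriv ^^ j) moebius_series) n * x ^ n) :: complex) sums
      of_real (eval_fps ((fps_deriv ^^ j) moebius_series) x)"
    by (intro sums_of_real sums_eval_fps)
  then have "(\<lambda>n. fps_nth ((fps_deriv ^^ j) moebius_series) n * of_real x ^ n :: complex) sums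
      of_real (eval_fps ((fps_deriv ^^ j) moebius_series) x)"
    by (simp only: fps_nth_moebius_derivs_of_real[where j = j] of_real_mult of_real_power)
  then show ?thesis by (simp add: eval_fps_def sums_iff)
qed

lemma tendsto_cis_minus_1_div: "((\<lambda>t. (cis t - 1) / of_real t) \<longlongrightarrow> \<i>) (at 0)"
proof -
  have "((\<lambda>t :: real. (cos t - 1) / t) \<longlongrightarrow> 0) (at 0)" "((\<lambda>t :: real. sin t / t) \<longlongrightarrow> 1) (at 0)"
    by real_asymp+
  then show ?thesis by (subst tendsto_complex_iff) (simp add: Re_divide_of_real Im_divide_of_real)
qed

text \<open>The third derivative is bounded on the closed disc of radius 1/2, which is convex,
  contains the circle of radius \<open>r\<close> and lies inside the unit disc. The linear term is
  absent because \<open>r\<close> is critical.\<close>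

lemma moebius_series_Taylor:
  assumes "0 < r" "r < 1 / 3" "deriv moebius_M r = 0"
  obtains B where "\<And>z :: complex. norm z \<le> 1 / 2 \<Longrightarrow>
    norm (eval_fps moebius_series z - of_real (moebius_M r) -
      of_real (deriv (deriv moebius_M) r / 2) * (z - of_real r)\<^sup>2) \<le> B * norm (z - of_real r) ^ 3"
proof -
  let ?f = "\<lambda>i. eval_fps ((fps_deriv ^^ i) (moebius_series :: complex fps))"
  let ?S = "cball (0 :: complex) (1 / 2)"
  have der: "(?f i has_field_derivative ?f (Suc i) x) (at x within T)" if "x \<in> ?S" for i x T
    using that by (intro has_field_derivative_moebius_derivs) auto
  have "continuous_on ?S (?f 3)"
    using der by (intro continuous_at_imp_continuous_on ballI DERIV_isCont) blast
  then have "compact (?f 3 ` ?S)" by (intro compact_continuous_image) auto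
  then obtain B where B: "\<And>x. x \<in> ?S \<Longrightarrow> norm (?f 3 x) \<le> B"
    using compact_imp_bounded bounded_iff by (metis imageI)
  have r1: "\<bar>r\<bar> < 1" using assms by simp
  have vals: "?f 0 (of_real r) = of_real (moebius_M r)" "?f 1 (of_real r) = 0"
      "?f 2 (of_real r) = of_real (deriv (deriv moebius_M) r)"
    using eval_moebius_derivs_of_real[OF r1, of 0] eval_moebius_derivs_of_real[OF r1, of 1]
      eval_moebius_derivs_of_real[OF r1, of 2] assms(3) deriv_moebius_M[OF r1] deriv_deriv_moebius_M[OF r1]
    by (simp_all add: moebius_M_eq numeral_2_eq_2)
  show ?thesis
  proof
    fix z :: complex assume z: "norm z \<le> 1 / 2"
    \<comment> \<open>The remainder comes with \<open>fact 2\<close>, hence the final constant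
      \<open>B / 2\<close>.\<close>
    have "norm (?f 0 z - (\<Sum>i\<le>2. ?f i (of_real r) * (z - of_real r) ^ i / fact i))
        \<le> B * norm (z - of_real r) ^ Suc 2 / fact 2"
    proof (rule complex_Taylor[where S = ?S])
      show "norm (?f (Suc 2) x) \<le> B" if "x \<in> ?S" for x using B[OF that] by (simp add: numeral_3_eq_3)
    qed (use der z assms in auto)
    moreover have "(\<Sum>i\<le>2. ?f i (of_real r) * (z - of_real r) ^ i / fact i) =
        of_real (moebius_M r) + of_real (deriv (deriv moebius_M) r / 2) * (z - of_real r)\<^sup>2"
    proof -
      have "{..2} = {0, 1, 2 :: nat}" by auto
      then show ?thesis using vals by simp
    qed
    ultimately show "norm (eval_fps moebius_series z - of_real (moebius_M r) -
      of_real (deriv (deriv moebius_M) r / 2) * (z - of_real r)\<^sup>2) \<le> B / 2 * norm (z - of_real r) ^ 3"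
      by (simp add: numeral_3_eq_3 diff_diff_eq)
  qed
qed

section \<open>The asymptotic formula\<close>

text \<open>Turns a bounded excess \<open>x\<close> of the denominator into exponential decay; the
  upper bound \<open>y\<close> makes the rate uniform.\<close>

lemma inverse_one_plus_le_exp:
  fixes x y :: real
  assumes "0 \<le> x" "x \<le> y"
  shows "1 / (1 + x) \<le> exp (- (x / (1 + y)))"
proof -
  have "1 / (1 + x) = 1 + - (x / (1 + x))" using assms by (simp add: field_simps)
  also have "\<dots> \<le> exp (- (x / (1 + x)))" by (rule exp_ge_add_one_self)
  also have "\<dots> \<le> exp (- (x / (1 + y)))" using assms by (simp add: divide_left_mono)
  finally show ?thesis .
qed

lemma norm_moebius_ratio_le:
  assumes r: "0 < r" "r \<le> 1 / 3"
  obtains \<alpha> where "\<alpha> > 0" "\<And>t. \<bar>t\<bar> \<le> pi \<Longrightarrow>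
    norm (of_real (moebius_M r) / eval_fps moebius_series (of_real r * cis t)) \<le> exp (- \<alpha> * t\<^sup>2)"
proof
  let ?m = "moebius_M r"
  have m: "?m > 0" by (rule moebius_M_pos[OF r])
  \<comment> \<open>The largest value of the \<open>x\<close> below, attained at
    \<open>cos t = -1\<close>.\<close>
  define y where "y = r\<^sup>2 / (2 * ?m)"
  \<comment> \<open>The product of \<open>r\<^sup>2 / (4 * ?m)\<close>, the 1/6 of
    \<open>one_minus_cos_ge\<close> and the loss \<open>1 / (1 + y)\<close>.\<close>
  define \<alpha> where "\<alpha> = r\<^sup>2 / (24 * ?m * (1 + y))"
  have y: "y > 0" using m r by (simp add: y_def)
  show "\<alpha> > 0" using m r y by (simp add: \<alpha>_def)
  fix t :: real assume t: "\<bar>t\<bar> \<le> pi"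
  define x where "x = r\<^sup>2 / (4 * ?m) * (1 - cos t)"
  have x0: "0 \<le> x" using m by (simp add: x_def)
  have "x \<le> r\<^sup>2 / (4 * ?m) * 2" unfolding x_def
    using m cos_ge_minus_one[of t] by (intro mult_left_mono) auto
  then have xy: "x \<le> y" by (simp add: y_def)
  have le: "?m * (1 + x) \<le> norm (eval_fps moebius_series (of_real r * cis t))"
    using norm_moebius_series_circle_ge[OF r, of t] m by (simp add: x_def distrib_left)
  have pos: "0 < ?m * (1 + x)" using m x0 by simp
  have "?m / norm (eval_fps moebius_series (of_real r * cis t)) \<le> ?m / (?m * (1 + x))"
    using m by (intro frac_le pos le) auto
  also have "\<dots> = 1 / (1 + x)" using m by simp
  also have "\<dots> \<le> exp (- (x / (1 + y)))" by (rule inverse_one_plus_le_exp[OF x0 xy])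
  also have "\<dots> \<le> exp (- \<alpha> * t\<^sup>2)"
  proof -
    have "r\<^sup>2 / (4 * ?m) * (t\<^sup>2 / 6) \<le> x" unfolding x_def
      using m one_minus_cos_ge[OF t] by (intro mult_left_mono) auto
    then have "r\<^sup>2 / (4 * ?m) * (t\<^sup>2 / 6) / (1 + y) \<le> x / (1 + y)"
      using y by (intro divide_right_mono) auto
    moreover have "r\<^sup>2 / (4 * ?m) * (t\<^sup>2 / 6) / (1 + y) = \<alpha> * t\<^sup>2" by (simp add: \<alpha>_def)
    ultimately show ?thesis by simp
  qed
  finally show "norm (of_real ?m / eval_fps moebius_series (of_real r * cis t)) \<le> exp (- \<alpha> * t\<^sup>2)"
    using m by (simp add: norm_divide)
qed

text \<open>The quotient minus 1 is (M(r) - M(z)) / M(z). To second order M(z) - M(r) is M''(r) (z -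
  r)^2 / 2, and (z - r) / t tends to i r. The double negation matches the form
  \<open>- of_real \<beta>\<close> in \<open>laplace_method\<close>.\<close>

lemma moebius_ratio_limit:
  assumes r: "0 < r" "r < 1 / 3" "deriv moebius_M r = 0"
  defines "m2 \<equiv> deriv (deriv moebius_M) r"
  shows "((\<lambda>t. (of_real (moebius_M r) / eval_fps moebius_series (of_real r * cis t) - 1) / of_real (t\<^sup>2))
    \<longlongrightarrow> - (of_real (- (r\<^sup>2 * m2 / (2 * moebius_M r))) :: complex)) (at 0)"
proof -
  let ?m = "of_real (moebius_M r) :: complex"
  let ?M = "\<lambda>t. eval_fps moebius_series (of_real r * cis t) :: complex"
  have m: "moebius_M r > 0" using r by (intro moebius_M_pos) auto
  have M0: "?M t \<noteq> 0" for t using r by (intro moebius_circle_nonzero) auto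
  obtain B where B: "\<And>z :: complex. norm z \<le> 1 / 2 \<Longrightarrow>
    norm (eval_fps moebius_series z - ?m - of_real (m2 / 2) * (z - of_real r)\<^sup>2) \<le> B * norm (z - of_real r) ^ 3"
    using moebius_series_Taylor[OF r] unfolding m2_def by blast
  define \<delta> where "\<delta> t = of_real r * cis t - of_real r" for t
  define D where "D t = \<delta> t / of_real t" for t
  define Q where "Q t = (?M t - ?m) / of_real (t\<^sup>2)" for t
  have D: "(D \<longlongrightarrow> of_real r * \<i>) (at 0)"
  proof -
    have "((\<lambda>t. of_real r * ((cis t - 1) / of_real t)) \<longlongrightarrow> of_real r * \<i>) (at 0)"
      by (intro tendsto_mult_left tendsto_cis_minus_1_div)
    moreover have "of_real r * ((cis t - 1) / of_real t) = D t" for t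
      by (simp add: D_def \<delta>_def right_diff_distrib)
    ultimately show ?thesis by simp
  qed
  have \<delta>: "(\<delta> \<longlongrightarrow> 0) (at 0)"
  proof -
    have "continuous_on UNIV \<delta>" unfolding \<delta>_def by (intro continuous_intros)
    then have "isCont \<delta> 0" by (simp add: continuous_on_eq_continuous_at)
    then show ?thesis by (simp add: isCont_def \<delta>_def)
  qed
  have "((\<lambda>t. B * (norm (D t))\<^sup>2 * norm (\<delta> t)) \<longlongrightarrow> B * (norm (of_real r * \<i>))\<^sup>2 * norm (0 :: complex)) (at 0)"
    by (intro tendsto_intros D \<delta>)
  then have null: "((\<lambda>t. B * (norm (D t))\<^sup>2 * norm (\<delta> t)) \<longlongrightarrow> 0) (at 0)" by simp
  have "((\<lambda>t. Q t - of_real (m2 / 2) * (D t)\<^sup>2) \<longlongrightarrow> 0) (at 0)"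
  proof (rule Lim_null_comparison[OF _ null])
    have "norm (Q t - of_real (m2 / 2) * (D t)\<^sup>2) \<le> B * (norm (D t))\<^sup>2 * norm (\<delta> t)" if "t \<noteq> 0" for t
    proof -
      have "Q t - of_real (m2 / 2) * (D t)\<^sup>2 = (?M t - ?m - of_real (m2 / 2) * (\<delta> t)\<^sup>2) / of_real (t\<^sup>2)"
        by (simp add: Q_def D_def power_divide diff_divide_distrib)
      then have "norm (Q t - of_real (m2 / 2) * (D t)\<^sup>2) =
          norm (?M t - ?m - of_real (m2 / 2) * (\<delta> t)\<^sup>2) / t\<^sup>2"
        by (simp add: norm_divide norm_power)
      also have "\<dots> \<le> B * norm (\<delta> t) ^ 3 / t\<^sup>2"
        unfolding \<delta>_def using r by (intro divide_right_mono B) (simp_all add: norm_mult)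
      also have "\<dots> = B * (norm (D t))\<^sup>2 * norm (\<delta> t)"
        using that by (simp add: D_def norm_divide power_divide power3_eq_cube power2_eq_square)
      finally show ?thesis .
    qed
    then show "eventually (\<lambda>t. norm (Q t - of_real (m2 / 2) * (D t)\<^sup>2) \<le> B * (norm (D t))\<^sup>2 * norm (\<delta> t)) (at 0)"
      unfolding eventually_at_filter by (intro always_eventually) blast
  qed
  moreover have "((\<lambda>t. of_real (m2 / 2) * (D t)\<^sup>2) \<longlongrightarrow> of_real (m2 / 2) * (of_real r * \<i>)\<^sup>2) (at 0)"
    by (intro tendsto_intros D)
  ultimately have "((\<lambda>t. Q t - of_real (m2 / 2) * (D t)\<^sup>2 + of_real (m2 / 2) * (D t)\<^sup>2) \<longlongrightarrow>
      0 + of_real (m2 / 2) * (of_real r * \<i>)\<^sup>2) (at 0)"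
    by (rule tendsto_add)
  then have Q: "(Q \<longlongrightarrow> of_real (m2 / 2) * (of_real r * \<i>)\<^sup>2) (at 0)" by simp
  have "isCont ?M 0"
    using continuous_moebius_circle[of r] r by (simp add: continuous_on_eq_continuous_at)
  moreover have "?M 0 = ?m"
    using eval_moebius_derivs_of_real[of r 0] r by (simp add: moebius_M_eq)
  ultimately have "(?M \<longlongrightarrow> ?m) (at 0)" by (simp add: isCont_def)
  then have "((\<lambda>t. - Q t / ?M t) \<longlongrightarrow> - (of_real (m2 / 2) * (of_real r * \<i>)\<^sup>2) / ?m) (at 0)"
    using m by (intro tendsto_divide tendsto_minus Q) auto
  moreover have "- Q t / ?M t = (?m / ?M t - 1) / of_real (t\<^sup>2)" for t
    using M0[of t] by (simp add: Q_def divide_simps)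
  moreover have "- (of_real (m2 / 2) * (of_real r * \<i>)\<^sup>2) / ?m = - of_real (- (r\<^sup>2 * m2 / (2 * moebius_M r)))"
    by (simp add: power_mult_distrib)
  ultimately show ?thesis by simp
qed

text \<open>The coefficient integral times M(r)^k is a Laplace integral. In its limit
  \<open>r\<close> occurs as the amplitude at 0 and inside \<open>\<beta>\<close>; the two cancel,
  so that \<open>c\<close> involves only M(r) and M''(r).\<close>

lemma moebius_coefficient_asymptotics:
  assumes r: "0 < r" "r < 1 / 3" "deriv moebius_M r = 0"
    and c: "c = sqrt (- moebius_M r / (2 * pi * deriv (deriv moebius_M) r))"
  shows "(\<lambda>k. fps_inv moebius_fps $ k / (c * inverse (moebius_M r) ^ k * real k powr (- 3 / 2))) \<longlonglongrightarrow> 1"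
proof -
  let ?m = "moebius_M r" and ?m2 = "deriv (deriv moebius_M) r"
  let ?M = "\<lambda>t. eval_fps moebius_series (of_real r * cis t) :: complex"
  define a where "a k = fps_inv moebius_fps $ k" for k
  define W where "W t = of_real ?m / ?M t" for t
  define \<beta> where "\<beta> = - (r\<^sup>2 * ?m2 / (2 * ?m))"
  define I where "I k = (\<integral>t. indicator {-pi..pi} t *\<^sub>R (of_real r * cis t / ?M t ^ k) \<partial>lborel)" for k
  have m: "?m > 0" using r by (intro moebius_M_pos) auto
  have m2: "?m2 < 0" using r by (intro deriv_deriv_moebius_M_neg) auto
  have \<beta>: "\<beta> > 0" using m m2 r by (simp add: \<beta>_def mult_less_0_iff divide_neg_pos)
  have "?m / (2 * pi * ?m2) < 0" using m m2 by (intro divide_pos_neg mult_pos_neg) auto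
  then have cpos: "c > 0" by (simp add: c)
  have M0: "?M t \<noteq> 0" for t using r by (intro moebius_circle_nonzero) auto
  have a: "system_fps $ k = complex_of_real (a k)" for k
  proof -
    have "a k = (system_fps :: real fps) $ k"
      unfolding a_def moebius_fps_def system_fps_eq_fps_inv ..
    then show ?thesis by (simp add: system_fps_def)
  qed
  obtain \<alpha> where \<alpha>: "\<alpha> > 0" "\<And>t. \<bar>t\<bar> \<le> pi \<Longrightarrow> norm (W t) \<le> exp (- \<alpha> * t\<^sup>2)"
    using norm_moebius_ratio_le[of r] r unfolding W_def by auto
  have "(\<lambda>k. sqrt (real k) *\<^sub>R (\<integral>t. indicator {-pi..pi} t *\<^sub>R (of_real r * cis t * W t ^ k) \<partial>lborel))
      \<longlonglongrightarrow> of_real r * cis 0 * of_real (sqrt (pi / \<beta>))"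
  proof (rule laplace_method[OF _ _ \<alpha> _ \<beta>])
    show "continuous_on UNIV W"
      unfolding W_def using r M0 by (intro continuous_intros continuous_moebius_circle) auto
    show "continuous_on UNIV (\<lambda>t. of_real r * cis t)" by (intro continuous_intros)
    show "W 0 = 1"
      using eval_moebius_derivs_of_real[of r 0] r m by (simp add: W_def moebius_M_eq)
    show "((\<lambda>t. (W t - 1) / of_real (t\<^sup>2)) \<longlongrightarrow> - of_real \<beta>) (at 0)"
      unfolding W_def \<beta>_def by (rule moebius_ratio_limit[OF r])
  qed
  moreover have "(\<integral>t. indicator {-pi..pi} t *\<^sub>R (of_real r * cis t * W t ^ k) \<partial>lborel) =
      of_real (?m ^ k) * I k" for k
  proof -
    have "indicator {-pi..pi} t *\<^sub>R (of_real r * cis t * W t ^ k) =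
        of_real (?m ^ k) * (indicator {-pi..pi} t *\<^sub>R (of_real r * cis t / ?M t ^ k))" for t
      by (simp add: W_def power_divide)
    then show ?thesis by (simp only: I_def integral_mult_right_zero)
  qed
  ultimately have lim: "(\<lambda>k. sqrt (real k) *\<^sub>R (of_real (?m ^ k) * I k)) \<longlonglongrightarrow> of_real (r * sqrt (pi / \<beta>))"
    by simp
  \<comment> \<open>Only eventually, as the integral formula requires
    \<open>k \<ge> 1\<close>.\<close>
  have "eventually (\<lambda>k. sqrt (real k) *\<^sub>R (of_real (?m ^ k) * I k) =
      complex_of_real (2 * pi * (real k * sqrt (real k) * ?m ^ k * a k))) sequentially"
    using eventually_ge_at_top[of 1]
  proof eventually_elim
    case (elim k)
    have "of_nat k * complex_of_real (a k) = of_real (1 / (2 * pi)) * I k"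
      using system_fps_nth_integral[OF r(1,2) elim] by (simp only: a I_def)
    then have "I k = of_real (2 * pi) * (of_nat k * of_real (a k))" by simp
    then show ?case by (simp add: scaleR_conv_of_real)
  qed
  with lim have "(\<lambda>k. complex_of_real (2 * pi * (real k * sqrt (real k) * ?m ^ k * a k)))
      \<longlonglongrightarrow> of_real (r * sqrt (pi / \<beta>))"
    by (rule Lim_transform_eventually)
  then have "(\<lambda>k. 2 * pi * (real k * sqrt (real k) * ?m ^ k * a k)) \<longlonglongrightarrow> r * sqrt (pi / \<beta>)"
    by (simp only: tendsto_of_real_iff)
  moreover have "r * sqrt (pi / \<beta>) = 2 * pi * c"
  proof -
    have "r * sqrt (pi / \<beta>) = sqrt (r\<^sup>2 * (pi / \<beta>))" using r by (simp only: real_sqrt_mult real_sqrt_abs abs_of_pos)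
    also have "r\<^sup>2 * (pi / \<beta>) = (2 * pi)\<^sup>2 * (- ?m / (2 * pi * ?m2))"
      using r m m2 by (simp add: \<beta>_def field_simps power2_eq_square)
    also have "sqrt \<dots> = sqrt ((2 * pi)\<^sup>2) * c" unfolding c by (rule real_sqrt_mult)
    also have "sqrt ((2 * pi)\<^sup>2) = 2 * pi" unfolding real_sqrt_abs by simp
    finally show ?thesis .
  qed
  ultimately have "(\<lambda>k. 2 * pi * (real k * sqrt (real k) * ?m ^ k * a k) / (2 * pi * c)) \<longlonglongrightarrow>
      2 * pi * c / (2 * pi * c)"
    using cpos by (intro tendsto_divide) auto
  then have "(\<lambda>k. 2 * pi * (real k * sqrt (real k) * ?m ^ k * a k) / (2 * pi * c)) \<longlonglongrightarrow> 1"
    using cpos by simp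
  moreover have "eventually (\<lambda>k. 2 * pi * (real k * sqrt (real k) * ?m ^ k * a k) / (2 * pi * c) =
      a k / (c * inverse ?m ^ k * real k powr (- 3 / 2))) sequentially"
    using eventually_ge_at_top[of 1]
  proof eventually_elim
    case (elim k)
    have "real k powr (3 / 2) = real k powr (1 + 1 / 2)" by simp
    also have "\<dots> = real k * sqrt (real k)"
      using elim by (subst powr_add) (simp add: powr_half_sqrt)
    finally have "real k powr (- 3 / 2) = inverse (real k * sqrt (real k))"
      using powr_minus[of "real k" "3 / 2"] by simp
    then show ?case using m cpos elim by (simp only:) (simp add: power_inverse divide_simps)
  qed
  ultimately show ?thesis unfolding a_def by (rule Lim_transform_eventually)
qed

theorem theorem2:
  fixes a :: "nat \<Rightarrow> real"
  assumes a_def: "\<And>k. a k = fps_nth (fps_inv moebius_fps) k"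
  shows "(\<forall>k\<ge>1. finite {C. natural_exact_covering_system C \<and> card C = k} \<and>
                 a k = real (card {C. natural_exact_covering_system C \<and> card C = k})) \<and>
         (\<exists>!\<tau>. smallest_zero_deriv_M \<tau>) \<and>
         (\<forall>\<tau> c \<gamma>. smallest_zero_deriv_M \<tau> \<longrightarrow>
            c = sqrt (- moebius_M \<tau> / (2 * pi * deriv (deriv moebius_M) \<tau>)) \<longrightarrow>
            \<gamma> = inverse (moebius_M \<tau>) \<longrightarrow>
            (\<lambda>k. a k / (c * \<gamma> ^ k * real k powr (-3/2))) \<longlonglongrightarrow> 1)"
  using fps_inv_moebius_nth ex1_smallest_zero_deriv_M moebius_coefficient_asymptotics
  by (simp add: a_def)

end
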